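(* Let $\Gamma$ be an infinite group with a finite symmetric generating set $S$, and denote the unit element of $\Gamma$ by $e$. Suppose that $X_\gamma$, $\gamma\in\Gamma$, is a $\Gamma$-factor-of-IID process over (the Cayley diagram of) $\Gamma$, where $X_\gamma$ takes values from a finite set. Given arbitrary nonnegative real numbers $\alpha_\sigma\ge 0$, $\sigma\in S$, with $\alpha_\sigma=\alpha_{\sigma^{-1}}$, we have $$\sum_{\sigma\in S}\alpha_\sigma H(X_e,X_\sigma)\ \ge\ \beta H(X_e),\qquad\text{where}\quad \beta=\inf_{W\subset\Gamma,\ |W|<\infty}\frac{\sum_{\sigma\in S}\alpha_\sigma|W\cup\sigma W|}{|W|}.$$
   Context: $\Gamma$ acts on itself by left multiplication. A $\Gamma$-factor-of-IID process with state space $M$ is $X=F(Z)$, where $Z=(Z_\gamma)_{\gamma\in\Gamma}$ are independent uniform $[0,1]$ random variables and $F:[0,1]^\Gamma\to M^\Gamma$ is measurable and equivariant with respect to the action of $\Gamma$ induced by left multiplication. $H$ denotes (joint) Shannon entropy ($\sum_j -p_j\log p_j$). The infimum is over nonempty finite $W$. *)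

theory Defs
  imports "HOL-Probability.Probability" "HOL-Algebra.Coset" "HOL-Algebra.Generated_Groups"
begin

definition uniform_unit :: "real measure" where
  "uniform_unit = restrict_space lborel {0..1}"

definition (in prob_space) iid_uniform :: "'g set \<Rightarrow> ('g \<Rightarrow> 'a \<Rightarrow> real) \<Rightarrow> bool" where
  "iid_uniform I Z \<longleftrightarrow>
     indep_vars (\<lambda>_. uniform_unit) Z I \<and>
     (\<forall>i\<in>I. distr M uniform_unit (Z i) = uniform_unit)"

(* The action on configurations z : \<Gamma> \<rightarrow> T induced by left multiplication:
   (g . z)(x) = z(g^{-1} x), so that the value at x is moved to g x.
   Configurations are extensional, i.e. undefined outside the carrier. *)
definition translate :: "('g, 'r) monoid_scheme \<Rightarrow> 'g \<Rightarrow> ('g \<Rightarrow> 't) \<Rightarrow> 'g \<Rightarrow> 't" where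
  "translate G g z = (\<lambda>x\<in>carrier G. z (inv\<^bsub>G\<^esub> g \<otimes>\<^bsub>G\<^esub> x))"

definition equivariant :: "('g, 'r) monoid_scheme \<Rightarrow> ('g \<Rightarrow> 's) set \<Rightarrow> (('g \<Rightarrow> 's) \<Rightarrow> ('g \<Rightarrow> 't)) \<Rightarrow> bool" where
  "equivariant G \<Omega> F \<longleftrightarrow>
     (\<forall>g\<in>carrier G. \<forall>z\<in>\<Omega>. F (translate G g z) = translate G g (F z))"

(* X = F(Z) with Z i.i.d. uniform on [0,1] and F : [0,1]^\<Gamma> \<rightarrow> T^\<Gamma> measurable (for the
   product sigma-algebras) and equivariant; T is the measurable state space. *)
definition (in prob_space) factor_of_iid ::
    "('g, 'r) monoid_scheme \<Rightarrow> 't measure \<Rightarrow> ('g \<Rightarrow> 'a \<Rightarrow> 't) \<Rightarrow> bool" where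
  "factor_of_iid G T X \<longleftrightarrow>
     (\<exists>Z F. iid_uniform (carrier G) Z \<and>
        F \<in> measurable (PiM (carrier G) (\<lambda>_. uniform_unit)) (PiM (carrier G) (\<lambda>_. T)) \<and>
        equivariant G (space (PiM (carrier G) (\<lambda>_. uniform_unit))) F \<and>
        (\<forall>\<omega>\<in>space M. \<forall>\<gamma>\<in>carrier G. X \<gamma> \<omega> = F (\<lambda>\<delta>\<in>carrier G. Z \<delta> \<omega>) \<gamma>))"

end

theory Submission
  imports Defs "HOL-Combinatorics.Multiset_Permutations" "HOL-Real_Asymp.Real_Asymp"
begin

text \<open>
Write \<open>X\<^sub>\<sigma> = f (Z\<^sub>\<sigma>\<^sub>\<gamma>)\<^sub>\<gamma>\<close> and suppose first that \<open>f\<close> reads only a finite-valued label \<open>Y\<^sub>\<gamma>\<close> of each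
\<open>Z\<^sub>\<gamma>\<close> with \<open>\<gamma>\<close> in a finite window \<open>B\<close>. Reveal the labels one after the other. By the chain rule the
entropy of \<open>X\<^sub>e\<close> is the sum, over all \<open>\<gamma>\<close>, of the information about \<open>X\<^sub>e\<close> gained when \<open>Y\<^sub>\<gamma>\<close> is
revealed. If there were a translation-invariant order on the group, one would reveal in that
order; a general group has none, but a uniformly random order of a finite set is as good. The
expected gain \<open>w \<gamma>\<close> is then the Shapley value of \<open>\<gamma>\<close> in the cooperative game that assigns to a set
\<open>U\<close> of players the mutual information of \<open>X\<^sub>e\<close> and \<open>(Y\<^sub>\<gamma>)\<close>, \<open>\<gamma> \<in> U\<close>. Three properties matter.

\<^item> The total gain is the entropy of \<open>X\<^sub>e\<close> (\<open>shapley_sum\<close>).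
\<^item> Translation invariance: because the labels are independent, elements outside the window
  contribute nothing, so the game depends on the window alone, and the expected gain about
  \<open>X\<^sub>\<sigma>\<close> at \<open>\<gamma>\<close> is \<open>w (\<sigma>\<^sup>-\<^sup>1 \<gamma>)\<close> (\<open>info_about_restrict\<close>, \<open>shapley_relabel\<close>).
\<^item> By submodularity of entropy, each step tells at least as much about the pair
  \<open>(X\<^sub>e, X\<^sub>\<sigma>)\<close> as about either of its entries (\<open>info_about_gain_mono\<close>).

Hence \<open>H(X\<^sub>e, X\<^sub>\<sigma>)\<close> is at least the sum of \<open>max (w \<gamma>) (w (\<sigma>\<^sup>-\<^sup>1 \<gamma>))\<close> over \<open>\<gamma>\<close>. The superlevel sets
of the function in this sum are \<open>W \<union> \<sigma>W\<close>, where \<open>W\<close> is the superlevel set of \<open>w\<close> at the same height.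
Applying the definition of \<open>\<beta>\<close> at every height and integrating over the heights
(\<open>isoperimetric_layer_cake\<close>) gives \<open>\<beta> H(X\<^sub>e)\<close> as a lower bound (\<open>finite_window_inequality\<close>).

A general measurable \<open>f\<close> agrees, outside an event of arbitrarily small probability, with a function
of the above kind (\<open>window_function_approximation\<close>), and the entropy of a variable with values in
a fixed finite set is continuous under this kind of convergence (\<open>entropy_tendsto\<close>).
\<close>

section \<open>Entropy of simple functions\<close>

text \<open>
Below, "\<open>D\<close> determines \<open>X\<close>" is always expressed through the level sets, as in the second hypothesis
here, and not through a function \<open>h\<close> with \<open>X = h \<circ> D\<close>. Entropy depends on the level sets only, so
in this form changing the encoding of a variable requires no explicit recoding maps.
\<close>
lemma simple_function_determined:
  assumes D: "simple_function M D"
    and det: "\<And>\<omega> \<omega>'. \<omega> \<in> space M \<Longrightarrow> \<omega>' \<in> space M \<Longrightarrow> D \<omega> = D \<omega>' \<Longrightarrow> X \<omega> = X \<omega>'"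
  shows "simple_function M X"
proof -
  define h where "h d = X (SOME \<omega>. \<omega> \<in> space M \<and> D \<omega> = d)" for d
  have "h (D \<omega>) = X \<omega>" if "\<omega> \<in> space M" for \<omega>
  proof -
    have "\<exists>\<omega>'. \<omega>' \<in> space M \<and> D \<omega>' = D \<omega>" using that by blast
    from someI_ex[OF this] show ?thesis
      unfolding h_def using that by (intro det) auto
  qed
  moreover have "simple_function M (\<lambda>\<omega>. h (D \<omega>))"
    using D by (rule simple_function_compose1)
  ultimately show ?thesis
    by (subst simple_function_cong[where g = "\<lambda>\<omega>. h (D \<omega>)"]) auto
qed

lemma simple_function_finite_codomain:
  assumes X: "X \<in> measurable M (count_space R)" and R: "finite R"
  shows "simple_function M X"
proof -
  have "X ` space M \<subseteq> R" using X by (auto dest: measurable_space)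
  then show ?thesis
    using R measurable_compose[OF X, of "\<lambda>x. x" "count_space UNIV"]
    by (auto simp: simple_function_eq_measurable intro: finite_subset)
qed

lemma sets_simple_function_neq:
  assumes "simple_function M X" "simple_function M Y"
  shows "{\<omega>\<in>space M. X \<omega> \<noteq> Y \<omega>} \<in> sets M"
proof -
  have "simple_function M (\<lambda>\<omega>. (X \<omega>, Y \<omega>))"
    using assms by (rule simple_function_Pair)
  then have "simple_function M (\<lambda>\<omega>. X \<omega> \<noteq> Y \<omega>)"
    by (rule simple_function_determined) auto
  then show ?thesis
    using simple_functionD(2)[of M "\<lambda>\<omega>. X \<omega> \<noteq> Y \<omega>" "{True}"]
    by (simp add: vimage_def Int_def conj_commute)
qed

context information_space
begin

text \<open>
Its negative logarithm is the surprisal of \<open>X\<close> at \<open>\<omega>\<close>.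
\<close>
abbreviation level_prob :: "('a \<Rightarrow> 'c) \<Rightarrow> 'a \<Rightarrow> real"
  where "level_prob X \<omega> \<equiv> prob (X -` {X \<omega>} \<inter> space M)"

lemma expectation_simple_function:
  fixes g :: "'c \<Rightarrow> real"
  assumes D: "simple_function M D"
  shows "expectation (\<lambda>\<omega>. g (D \<omega>)) = (\<Sum>d\<in>D ` space M. prob (D -` {d} \<inter> space M) * g d)"
proof -
  note sd = simple_distributedI[OF D measure_nonneg refl]
  have "expectation (\<lambda>\<omega>. g (D \<omega>)) =
      (\<integral>d. prob (D -` {d} \<inter> space M) * g d \<partial>count_space (D ` space M))"
    by (rule distributed_integral[OF simple_distributed[OF sd], symmetric]) auto
  then show ?thesis
    using simple_functionD(1)[OF D] by (simp add: lebesgue_integral_count_space_finite)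
qed

text \<open>
Entropy as expected surprisal is an integral over the sample space, whatever the codomain of \<open>X\<close>.
Identities between entropies of variables with different codomains thus reduce to pointwise
identities between level sets.
\<close>
lemma entropy_eq_expectation:
  assumes "simple_function M X"
  shows "\<H>(X) = expectation (\<lambda>\<omega>. - log b (level_prob X \<omega>))"
  using expectation_simple_function[OF assms, of "\<lambda>x. - log b (prob (X -` {x} \<inter> space M))"]
    entropy_simple_distributed[OF simple_distributedI[OF assms measure_nonneg refl]]
  by (simp add: sum_negf)

lemma entropy_cong_levels:
  assumes X: "simple_function M X"
    and eq: "\<And>\<omega> \<omega>'. \<omega> \<in> space M \<Longrightarrow> \<omega>' \<in> space M \<Longrightarrow> X \<omega> = X \<omega>' \<longleftrightarrow> Y \<omega> = Y \<omega>'"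
  shows "\<H>(X) = \<H>(Y)"
proof -
  have Y: "simple_function M Y"
    using simple_function_determined[OF X] eq by blast
  have "X -` {X \<omega>} \<inter> space M = Y -` {Y \<omega>} \<inter> space M" if "\<omega> \<in> space M" for \<omega>
    using eq that by auto
  then show ?thesis
    unfolding entropy_eq_expectation[OF X] entropy_eq_expectation[OF Y]
    by (intro Bochner_Integration.integral_cong) auto
qed

text \<open>
Only finitely many level sets exist, so those of probability zero form a null set; off that set the
logarithms of level probabilities obey the usual product rules.
\<close>
lemma AE_level_prob_pos:
  assumes D: "simple_function M D"
  shows "AE \<omega> in M. 0 < level_prob D \<omega>"
proof -
  have "AE \<omega> in M. \<forall>d\<in>D ` space M. prob (D -` {d} \<inter> space M) = 0 \<longrightarrow> D \<omega> \<noteq> d"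
  proof (rule AE_finite_allI[OF simple_functionD(1)[OF D]])
    fix d assume "d \<in> D ` space M"
    show "AE \<omega> in M. prob (D -` {d} \<inter> space M) = 0 \<longrightarrow> D \<omega> \<noteq> d"
    proof (cases "prob (D -` {d} \<inter> space M) = 0")
      case True
      then have "D -` {d} \<inter> space M \<in> null_sets M"
        using simple_functionD(2)[OF D] by (auto simp: null_sets_def emeasure_eq_measure)
      then show ?thesis by (rule AE_I'[THEN AE_mp]) auto
    qed auto
  qed
  then show ?thesis
    by (rule AE_mp) (auto simp: zero_less_measure_iff)
qed

lemma integrable_simple_real:
  assumes "simple_function M D"
  shows "integrable M (\<lambda>\<omega>. (g (D \<omega>)::real))"
proof (rule integrable_const_bound[where B = "Max ((\<lambda>d. \<bar>g d\<bar>) ` D ` space M)"])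
  show "AE \<omega> in M. norm (g (D \<omega>)) \<le> Max ((\<lambda>d. \<bar>g d\<bar>) ` D ` space M)"
    using simple_functionD(1)[OF assms] by (intro AE_I2) (auto intro!: Max_ge)
  show "(\<lambda>\<omega>. g (D \<omega>)) \<in> borel_measurable M"
    using borel_measurable_simple_function[OF simple_function_compose1[OF assms, of g]] by simp
qed

lemma integrable_surprisal:
  assumes "simple_function M X"
  shows "integrable M (\<lambda>\<omega>. - log b (level_prob X \<omega>))"
  using integrable_simple_real[OF assms, of "\<lambda>x. - log b (prob (X -` {x} \<inter> space M))"] .

text \<open>
This is the nonnegativity of the conditional mutual information of \<open>X\<close> and \<open>Y\<close> given \<open>Z\<close>, whose
integrand splits into four surprisals wherever all level probabilities are positive.
\<close>
lemma entropy_submodular: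
  assumes sf: "simple_function M X" "simple_function M Y" "simple_function M Z"
  shows "\<H>(\<lambda>\<omega>. (X \<omega>, Y \<omega>, Z \<omega>)) + \<H>(Z) \<le> \<H>(\<lambda>\<omega>. (X \<omega>, Z \<omega>)) + \<H>(\<lambda>\<omega>. (Y \<omega>, Z \<omega>))"
proof -
  define D where "D \<omega> = (X \<omega>, Y \<omega>, Z \<omega>)" for \<omega>
  define XZ where "XZ \<omega> = (X \<omega>, Z \<omega>)" for \<omega>
  define YZ where "YZ \<omega> = (Y \<omega>, Z \<omega>)" for \<omega>
  have sfs: "simple_function M D" "simple_function M XZ" "simple_function M YZ"
    unfolding D_def XZ_def YZ_def using sf by (auto intro!: simple_function_Pair)
  note sd = simple_distributedI[OF _ measure_nonneg refl]
  have "0 \<le> \<I>(X ; Y | Z)"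
    using sf by (rule conditional_mutual_information_nonneg)
  also have "\<dots> = (\<Sum>(x, y, z)\<in>D ` space M. prob (D -` {(x,y,z)} \<inter> space M) *
      log b (prob (D -` {(x,y,z)} \<inter> space M) /
        (prob (XZ -` {(x,z)} \<inter> space M) * (prob (YZ -` {(y,z)} \<inter> space M) / prob (Z -` {z} \<inter> space M)))))"
    unfolding D_def XZ_def YZ_def
    by (rule conditional_mutual_information_eq[OF sd sd sd sd])
      (use sf in \<open>auto intro!: simple_function_Pair\<close>)
  also have "\<dots> = expectation (\<lambda>\<omega>. log b (level_prob D \<omega> /
        (level_prob XZ \<omega> * (level_prob YZ \<omega> / level_prob Z \<omega>))))"
    using expectation_simple_function[OF sfs(1), of "\<lambda>(x,y,z).
      log b (prob (D -` {(x,y,z)} \<inter> space M) /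
        (prob (XZ -` {(x,z)} \<inter> space M) * (prob (YZ -` {(y,z)} \<inter> space M) / prob (Z -` {z} \<inter> space M))))"]
    by (simp add: case_prod_unfold D_def XZ_def YZ_def)
  also have "\<dots> = expectation (\<lambda>\<omega>. - log b (level_prob XZ \<omega>) + - log b (level_prob YZ \<omega>)
      - (- log b (level_prob D \<omega>) + - log b (level_prob Z \<omega>)))"
  proof (rule integral_cong_AE)
    have m: "(\<lambda>\<omega>. level_prob V \<omega>) \<in> borel_measurable M" if "simple_function M V" for V :: "'a \<Rightarrow> 'z"
      using borel_measurable_integrable[OF integrable_simple_real[OF that, of "\<lambda>v. prob (V -` {v} \<inter> space M)"]] .
    note [measurable] = m[OF sfs(1)] m[OF sfs(2)] m[OF sfs(3)] m[OF sf(3)]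
    show "(\<lambda>\<omega>. log b (level_prob D \<omega> /
        (level_prob XZ \<omega> * (level_prob YZ \<omega> / level_prob Z \<omega>)))) \<in> borel_measurable M"
      by measurable
    show "(\<lambda>\<omega>. - log b (level_prob XZ \<omega>) + - log b (level_prob YZ \<omega>)
      - (- log b (level_prob D \<omega>) + - log b (level_prob Z \<omega>))) \<in> borel_measurable M"
      by measurable
    show "AE \<omega> in M. log b (level_prob D \<omega> /
        (level_prob XZ \<omega> * (level_prob YZ \<omega> / level_prob Z \<omega>))) =
      - log b (level_prob XZ \<omega>) + - log b (level_prob YZ \<omega>)
      - (- log b (level_prob D \<omega>) + - log b (level_prob Z \<omega>))"
      using AE_level_prob_pos[OF sfs(1)] AE_level_prob_pos[OF sfs(2)]
        AE_level_prob_pos[OF sfs(3)] AE_level_prob_pos[OF sf(3)]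
    proof eventually_elim
      case (elim \<omega>)
      then show ?case using b_gt_1 by (simp add: log_mult log_divide)
    qed
  qed
  also have "\<dots> = \<H>(XZ) + \<H>(YZ) - (\<H>(D) + \<H>(Z))"
    unfolding entropy_eq_expectation[OF sfs(1)] entropy_eq_expectation[OF sfs(2)]
      entropy_eq_expectation[OF sfs(3)] entropy_eq_expectation[OF sf(3)]
    by (simp only: Bochner_Integration.integral_diff[OF Bochner_Integration.integrable_add
            Bochner_Integration.integrable_add]
          Bochner_Integration.integral_add integrable_surprisal sfs sf)
  finally show ?thesis by (simp add: D_def[abs_def] XZ_def[abs_def] YZ_def[abs_def])
qed

text \<open>
The partition form of submodularity: \<open>D\<close> plays the join of \<open>A\<close> and \<open>B\<close>, while \<open>C\<close> is any common
coarsening of the two.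
\<close>
lemma entropy_submodular_levels:
  assumes sf: "simple_function M A" "simple_function M B"
    and C: "\<And>\<omega> \<omega>'. \<omega> \<in> space M \<Longrightarrow> \<omega>' \<in> space M \<Longrightarrow> A \<omega> = A \<omega>' \<Longrightarrow> C \<omega> = C \<omega>'"
      "\<And>\<omega> \<omega>'. \<omega> \<in> space M \<Longrightarrow> \<omega>' \<in> space M \<Longrightarrow> B \<omega> = B \<omega>' \<Longrightarrow> C \<omega> = C \<omega>'"
    and D: "\<And>\<omega> \<omega>'. \<omega> \<in> space M \<Longrightarrow> \<omega>' \<in> space M \<Longrightarrow> D \<omega> = D \<omega>' \<longleftrightarrow> A \<omega> = A \<omega>' \<and> B \<omega> = B \<omega>'"
  shows "\<H>(D) + \<H>(C) \<le> \<H>(A) + \<H>(B)"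
proof -
  have sfC: "simple_function M C"
    using simple_function_determined[OF sf(1)] C(1) by blast
  have "\<H>(\<lambda>\<omega>. (A \<omega>, C \<omega>)) = \<H>(A)"
    by (rule entropy_cong_levels[OF simple_function_Pair[OF sf(1) sfC]]) (use C(1) in blast)
  moreover have "\<H>(\<lambda>\<omega>. (B \<omega>, C \<omega>)) = \<H>(B)"
    by (rule entropy_cong_levels[OF simple_function_Pair[OF sf(2) sfC]]) (use C(2) in blast)
  moreover have "\<H>(\<lambda>\<omega>. (A \<omega>, B \<omega>, C \<omega>)) = \<H>(D)"
    by (rule entropy_cong_levels[OF simple_function_Pair[OF sf(1) simple_function_Pair[OF sf(2) sfC]]])
      (use C(1) D in \<open>unfold prod.inject, blast\<close>)
  ultimately show ?thesis using entropy_submodular[OF sf sfC] by simp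
qed

lemma entropy_indep_pair:
  assumes X: "simple_function M X" and Y: "simple_function M Y"
    and ind: "indep_var (count_space (X ` space M)) X (count_space (Y ` space M)) Y"
  shows "\<H>(\<lambda>\<omega>. (X \<omega>, Y \<omega>)) = \<H>(X) + \<H>(Y)"
proof -
  have "\<I>(X ; Y) = 0"
    using ind mutual_information_indep_vars by blast
  then have "\<H>(\<lambda>\<omega>. (Y \<omega>, X \<omega>)) = \<H>(X) + \<H>(Y)"
    using mutual_information_eq_entropy_conditional_entropy[OF X Y] entropy_chain_rule[OF Y X] by simp
  then show ?thesis
    using entropy_cong_levels[OF simple_function_Pair[OF X Y], of "\<lambda>\<omega>. (Y \<omega>, X \<omega>)"] by auto
qed

lemma entropy_finite_codomain:
  assumes X: "simple_function M X" and A: "finite A" "X ` space M \<subseteq> A"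
  shows "entropy b (count_space A) X =
      (\<Sum>a\<in>A. - (prob (X -` {a} \<inter> space M) * log b (prob (X -` {a} \<inter> space M))))"
proof -
  have meas[measurable]: "X \<in> measurable M (count_space A)"
    using simple_functionD(2)[OF X] A by (subst measurable_count_space_eq2) auto
  have "distributed M (count_space A) X (\<lambda>a. ennreal (prob (X -` {a} \<inter> space M)))"
    unfolding distributed_def
  proof (intro conjI meas)
    show "distr M (count_space A) X = density (count_space A) (\<lambda>a. ennreal (prob (X -` {a} \<inter> space M)))"
      using A(1) by (intro measure_eqI_finite[of _ A])
        (auto simp: emeasure_distr emeasure_density emeasure_eq_measure nn_integral_count_space_finite
          sum.If_cases intro!: arg_cong[where f = prob])
  qed auto
  from entropy_distr[OF this] show ?thesis
    using A(1) by (simp add: lebesgue_integral_count_space_finite sum_negf)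
qed

text \<open>
Values that are never attained contribute \<open>0 * log b 0 = 0\<close>.
\<close>
lemma entropy_enlarge_codomain:
  assumes X: "simple_function M X" and A: "finite A" "X ` space M \<subseteq> A"
  shows "entropy b (count_space A) X = \<H>(X)"
proof -
  have "prob (X -` {a} \<inter> space M) = 0" if "a \<in> A - X ` space M" for a
  proof -
    have "X -` {a} \<inter> space M = {}" using that by auto
    then show ?thesis by simp
  qed
  then show ?thesis
    unfolding entropy_finite_codomain[OF X A] entropy_finite_codomain[OF X simple_functionD(1)[OF X] order_refl]
    using A by (intro sum.mono_neutral_right) auto
qed

text \<open>
The map \<open>T\<close> may fail to be surjective, so the two variables are compared through their common
codomain, the image of \<open>X\<close>, and not through their images.
\<close>
lemma entropy_measure_preserving:
  assumes X: "simple_function M X" and T: "T \<in> measurable M M" "distr M M T = M"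
  shows "\<H>(\<lambda>\<omega>. X (T \<omega>)) = \<H>(X)"
proof -
  have meas: "X \<in> measurable M (count_space (X ` space M))"
    using simple_functionD[OF X] by (subst measurable_count_space_eq2) auto
  have im: "(\<lambda>\<omega>. X (T \<omega>)) ` space M \<subseteq> X ` space M"
    using measurable_space[OF T(1)] by auto
  have sf: "simple_function M (\<lambda>\<omega>. X (T \<omega>))"
    using finite_subset[OF im simple_functionD(1)[OF X]]
      measurable_compose[OF T(1) measurable_simple_function[OF X]]
    by (simp add: simple_function_eq_measurable)
  have "\<H>(\<lambda>\<omega>. X (T \<omega>)) = entropy b (count_space (X ` space M)) (X \<circ> T)"
    using entropy_enlarge_codomain[OF sf simple_functionD(1)[OF X] im] by (simp add: comp_def)
  also have "\<dots> = \<H>(X)"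
    unfolding entropy_def distr_distr[OF meas T(1), symmetric] T(2) ..
  finally show ?thesis .
qed

end

section \<open>Information carried by sets of labels\<close>

definition tuple :: "('i \<Rightarrow> 'a \<Rightarrow> 'd) \<Rightarrow> 'i set \<Rightarrow> 'a \<Rightarrow> 'i \<Rightarrow> 'd"
  where "tuple Y U \<omega> = (\<lambda>i\<in>U. Y i \<omega>)"

lemma tuple_eq_iff: "tuple Y U \<omega> = tuple Y U \<omega>' \<longleftrightarrow> (\<forall>i\<in>U. Y i \<omega> = Y i \<omega>')"
  by (auto simp: tuple_def restrict_def fun_eq_iff)

lemma simple_function_tuple:
  assumes "finite U" "\<And>i. i \<in> U \<Longrightarrow> simple_function M (Y i)"
  shows "simple_function M (tuple Y U)"
  using assms
proof (induction U)
  case empty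
  then show ?case by (simp add: tuple_def restrict_def)
next
  case (insert i U)
  then have "simple_function M (\<lambda>\<omega>. (Y i \<omega>, tuple Y U \<omega>))"
    by (intro simple_function_Pair) auto
  then show ?case
    by (rule simple_function_determined) (auto simp: tuple_eq_iff)
qed

context information_space
begin

text \<open>
The mutual information of \<open>X\<close> and the labels \<open>Y i\<close>, \<open>i \<in> U\<close>, written with entropies. As a function of
\<open>U\<close> it is the cooperative game whose Shapley value is used below.
\<close>
definition info_about :: "('i \<Rightarrow> 'a \<Rightarrow> 'd) \<Rightarrow> ('a \<Rightarrow> 'x) \<Rightarrow> 'i set \<Rightarrow> real"
  where "info_about Y X U = \<H>(tuple Y U) + \<H>(X) - \<H>(\<lambda>\<omega>. (tuple Y U \<omega>, X \<omega>))"

lemma info_about_empty: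
  assumes X: "simple_function M X"
  shows "info_about Y X {} = 0"
proof -
  have "\<H>(\<lambda>\<omega>. (tuple Y {} \<omega>, X \<omega>)) = \<H>(X)"
    using entropy_cong_levels[OF X, of "\<lambda>\<omega>. (tuple Y {} \<omega>, X \<omega>)"] by (simp add: tuple_eq_iff)
  moreover have "\<H>(tuple Y {}) = 0"
  proof -
    have "tuple Y {} -` {tuple Y {} \<omega>} \<inter> space M = space M" for \<omega>
      by (auto simp: tuple_eq_iff)
    moreover have "simple_function M (tuple Y {})"
      by (rule simple_function_tuple) auto
    ultimately show ?thesis
      by (simp add: entropy_eq_expectation prob_space)
  qed
  ultimately show ?thesis by (simp add: info_about_def)
qed

lemma info_about_determined:
  assumes Y: "simple_function M (tuple Y U)"
    and det: "\<And>\<omega> \<omega>'. \<omega> \<in> space M \<Longrightarrow> \<omega>' \<in> space M \<Longrightarrow> \<forall>i\<in>U. Y i \<omega> = Y i \<omega>' \<Longrightarrow> X \<omega> = X \<omega>'"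
  shows "info_about Y X U = \<H>(X)"
proof -
  have "\<H>(tuple Y U) = \<H>(\<lambda>\<omega>. (tuple Y U \<omega>, X \<omega>))"
    by (rule entropy_cong_levels[OF Y]) (use det in \<open>unfold tuple_eq_iff prod.inject, blast\<close>)
  then show ?thesis by (simp add: info_about_def)
qed

text \<open>
The gain at \<open>j\<close> is the conditional mutual information of \<open>X\<close> and \<open>Y j\<close> given the labels in \<open>U\<close>, and
conditional mutual information grows when \<open>X\<close> is refined to \<open>X'\<close>. In terms of entropies this is one
instance of submodularity, since the entropies of the labels alone and of \<open>X\<close> and \<open>X'\<close> alone cancel.
\<close>
lemma info_about_gain_mono:
  assumes Y: "\<And>i. i \<in> insert j U \<Longrightarrow> simple_function M (Y i)" and U: "finite U"
    and X': "simple_function M X'"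
    and det: "\<And>\<omega> \<omega>'. \<omega> \<in> space M \<Longrightarrow> \<omega>' \<in> space M \<Longrightarrow> X' \<omega> = X' \<omega>' \<Longrightarrow> X \<omega> = X \<omega>'"
  shows "info_about Y X (insert j U) - info_about Y X U
      \<le> info_about Y X' (insert j U) - info_about Y X' U"
proof -
  have X: "simple_function M X"
    by (rule simple_function_determined[OF X' det])
  have T: "simple_function M (tuple Y (insert j U))" "simple_function M (tuple Y U)"
    using Y U by (auto intro!: simple_function_tuple)
  have "\<H>(\<lambda>\<omega>. (tuple Y (insert j U) \<omega>, X' \<omega>)) + \<H>(\<lambda>\<omega>. (tuple Y U \<omega>, X \<omega>))
      \<le> \<H>(\<lambda>\<omega>. (tuple Y (insert j U) \<omega>, X \<omega>)) + \<H>(\<lambda>\<omega>. (tuple Y U \<omega>, X' \<omega>))"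
    by (rule entropy_submodular_levels)
      (use T X X' in \<open>auto simp: tuple_eq_iff intro: det simple_function_Pair\<close>)
  then show ?thesis by (simp add: info_about_def)
qed

lemma info_about_gain_nonneg:
  assumes Y: "\<And>i. i \<in> insert j U \<Longrightarrow> simple_function M (Y i)" and U: "finite U"
    and X: "simple_function M X"
  shows "info_about Y X U \<le> info_about Y X (insert j U)"
proof -
  \<comment> \<open>The game of a constant is itself constant, so all its gains vanish.\<close>
  have "info_about Y (\<lambda>_. True) V = \<H>(\<lambda>_. True)" if "simple_function M (tuple Y V)" for V
    using entropy_cong_levels[OF that, of "\<lambda>\<omega>. (tuple Y V \<omega>, True)"] by (simp add: info_about_def)
  moreover have "simple_function M (tuple Y (insert j U))" "simple_function M (tuple Y U)"
    using Y U by (auto intro!: simple_function_tuple)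
  ultimately have "info_about Y (\<lambda>_. True) (insert j U) = info_about Y (\<lambda>_. True) U"
    by simp
  moreover have "info_about Y (\<lambda>_. True) (insert j U) - info_about Y (\<lambda>_. True) U
      \<le> info_about Y X (insert j U) - info_about Y X U"
    by (rule info_about_gain_mono) (use Y U X in auto)
  ultimately show ?thesis by simp
qed

text \<open>
Variables that read disjoint sets of independent labels are independent, so their entropies add.
The notion \<open>indep_var\<close> requires both variables to have values in the same type; the next lemma
removes this restriction by embedding the two types into their sum.
\<close>
lemma entropy_pair_of_disjoint_tuples_same_type:
  fixes A C :: "'a \<Rightarrow> 'x"
  assumes ind: "indep_vars (\<lambda>_. count_space R) Y I" and R: "finite R"
    and UV: "finite U" "finite V" "U \<inter> V = {}" "U \<subseteq> I" "V \<subseteq> I"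
    and A: "\<And>\<omega> \<omega>'. \<omega> \<in> space M \<Longrightarrow> \<omega>' \<in> space M \<Longrightarrow> tuple Y U \<omega> = tuple Y U \<omega>' \<Longrightarrow> A \<omega> = A \<omega>'"
    and C: "\<And>\<omega> \<omega>'. \<omega> \<in> space M \<Longrightarrow> \<omega>' \<in> space M \<Longrightarrow> tuple Y V \<omega> = tuple Y V \<omega>' \<Longrightarrow> C \<omega> = C \<omega>'"
  shows "\<H>(\<lambda>\<omega>. (A \<omega>, C \<omega>)) = \<H>(A) + \<H>(C)"
proof -
  obtain \<omega>0 where \<omega>0: "\<omega>0 \<in> space M" using not_empty by blast
  have factor: "\<exists>h. \<forall>\<omega>\<in>space M. h (t \<omega>) = A \<omega>"
    if det: "\<And>\<omega> \<omega>'. \<omega> \<in> space M \<Longrightarrow> \<omega>' \<in> space M \<Longrightarrow> t \<omega> = t \<omega>' \<Longrightarrow> A \<omega> = A \<omega>'"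
    for t :: "'a \<Rightarrow> 'k" and A :: "'a \<Rightarrow> 'l"
  proof (intro exI ballI)
    fix \<omega> assume \<omega>: "\<omega> \<in> space M"
    then have "\<exists>\<omega>'. \<omega>' \<in> space M \<and> t \<omega>' = t \<omega>" by blast
    from someI_ex[OF this] show "A (SOME \<omega>'. \<omega>' \<in> space M \<and> t \<omega>' = t \<omega>) = A \<omega>"
      using \<omega> by (intro det) auto
  qed
  have "\<exists>h. \<forall>\<omega>\<in>space M. h (tuple Y U \<omega>) = A \<omega>"
    by (rule factor) (rule A)
  then obtain h where h: "\<And>\<omega>. \<omega> \<in> space M \<Longrightarrow> h (tuple Y U \<omega>) = A \<omega>"
    by blast
  have "\<exists>k. \<forall>\<omega>\<in>space M. k (tuple Y V \<omega>) = C \<omega>"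
    by (rule factor) (rule C)
  then obtain k where k: "\<And>\<omega>. \<omega> \<in> space M \<Longrightarrow> k (tuple Y V \<omega>) = C \<omega>"
    by blast
  define h' where "h' t = (if h t \<in> A ` space M then h t else A \<omega>0)" for t
  define k' where "k' t = (if k t \<in> C ` space M then k t else C \<omega>0)" for t
  have h': "h' (tuple Y U \<omega>) = A \<omega>" and k': "k' (tuple Y V \<omega>) = C \<omega>" if "\<omega> \<in> space M" for \<omega>
    using h[OF that] k[OF that] that by (auto simp: h'_def k'_def)
  have im: "(h' \<circ> tuple Y U) ` space M = A ` space M" "(k' \<circ> tuple Y V) ` space M = C ` space M"
    using h' k' by (auto simp: image_iff)
  have Y: "simple_function M (Y i)" if "i \<in> I" for i
    using ind that R by (intro simple_function_finite_codomain[where R = R]) (auto simp: indep_vars_def)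
  have TU: "simple_function M (tuple Y U)" and TV: "simple_function M (tuple Y V)"
    using UV Y by (auto intro!: simple_function_tuple)
  have "indep_var (PiM U (\<lambda>_. count_space R)) (tuple Y U) (PiM V (\<lambda>_. count_space R)) (tuple Y V)"
    using indep_var_restrict[OF ind UV(3-5)] by (simp add: tuple_def[abs_def])
  then have "indep_var (count_space (A ` space M)) (h' \<circ> tuple Y U) (count_space (C ` space M)) (k' \<circ> tuple Y V)"
    using UV R \<omega>0 by (intro indep_var_compose)
      (auto simp: count_space_PiM_finite countable_finite h'_def k'_def)
  then have "\<H>(\<lambda>\<omega>. ((h' \<circ> tuple Y U) \<omega>, (k' \<circ> tuple Y V) \<omega>)) = \<H>(h' \<circ> tuple Y U) + \<H>(k' \<circ> tuple Y V)"
    using TU TV by (intro entropy_indep_pair) (simp_all only: im simple_function_compose)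
  moreover have "\<H>(\<lambda>\<omega>. ((h' \<circ> tuple Y U) \<omega>, (k' \<circ> tuple Y V) \<omega>)) = \<H>(\<lambda>\<omega>. (A \<omega>, C \<omega>))"
    by (rule entropy_cong_levels[OF simple_function_Pair[OF simple_function_compose[OF TU]
            simple_function_compose[OF TV]]]) (simp add: h' k')
  moreover have "\<H>(h' \<circ> tuple Y U) = \<H>(A)"
    by (rule entropy_cong_levels[OF simple_function_compose[OF TU]]) (simp add: h')
  moreover have "\<H>(k' \<circ> tuple Y V) = \<H>(C)"
    by (rule entropy_cong_levels[OF simple_function_compose[OF TV]]) (simp add: k')
  ultimately show ?thesis by simp
qed

lemma entropy_pair_of_disjoint_tuples:
  fixes A :: "'a \<Rightarrow> 'x" and C :: "'a \<Rightarrow> 'y"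
  assumes ind: "indep_vars (\<lambda>_. count_space R) Y I" and R: "finite R"
    and UV: "finite U" "finite V" "U \<inter> V = {}" "U \<subseteq> I" "V \<subseteq> I"
    and A: "\<And>\<omega> \<omega>'. \<omega> \<in> space M \<Longrightarrow> \<omega>' \<in> space M \<Longrightarrow> tuple Y U \<omega> = tuple Y U \<omega>' \<Longrightarrow> A \<omega> = A \<omega>'"
    and C: "\<And>\<omega> \<omega>'. \<omega> \<in> space M \<Longrightarrow> \<omega>' \<in> space M \<Longrightarrow> tuple Y V \<omega> = tuple Y V \<omega>' \<Longrightarrow> C \<omega> = C \<omega>'"
    and sf: "simple_function M A" "simple_function M C"
  shows "\<H>(\<lambda>\<omega>. (A \<omega>, C \<omega>)) = \<H>(A) + \<H>(C)"
proof -
  define A' where "A' \<omega> = (Inl (A \<omega>) :: 'x + 'y)" for \<omega>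
  define C' where "C' \<omega> = (Inr (C \<omega>) :: 'x + 'y)" for \<omega>
  have A': "A' \<omega> = A' \<omega>' \<longleftrightarrow> A \<omega> = A \<omega>'" and C': "C' \<omega> = C' \<omega>' \<longleftrightarrow> C \<omega> = C \<omega>'" for \<omega> \<omega>'
    by (simp_all add: A'_def C'_def)
  have "\<H>(\<lambda>\<omega>. (A \<omega>, C \<omega>)) = \<H>(\<lambda>\<omega>. (A' \<omega>, C' \<omega>))"
    by (rule entropy_cong_levels[OF simple_function_Pair[OF sf]]) (simp add: A' C')
  also have "\<dots> = \<H>(A') + \<H>(C')"
    by (rule entropy_pair_of_disjoint_tuples_same_type[OF ind R UV]; unfold A' C'; rule A C; assumption)
  also have "\<H>(A') = \<H>(A)"
    by (rule entropy_cong_levels[OF sf(1), symmetric]) (simp add: A')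
  also have "\<H>(C') = \<H>(C)"
    by (rule entropy_cong_levels[OF sf(2), symmetric]) (simp add: C')
  finally show ?thesis .
qed

text \<open>
Labels outside the window are independent of the labels inside and of \<open>X\<close> together. They add the
same amount to the entropy of the labels with and without \<open>X\<close>, and cancel in the mutual information.
\<close>
lemma info_about_restrict:
  assumes ind: "indep_vars (\<lambda>_. count_space R) Y I" and R: "finite R"
    and U: "finite U" "U \<subseteq> I" and B: "finite B" "B \<subseteq> I"
    and det: "\<And>\<omega> \<omega>'. \<omega> \<in> space M \<Longrightarrow> \<omega>' \<in> space M \<Longrightarrow> \<forall>i\<in>B. Y i \<omega> = Y i \<omega>' \<Longrightarrow> X \<omega> = X \<omega>'"
    and sf: "simple_function M X" "\<And>i. i \<in> I \<Longrightarrow> simple_function M (Y i)"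
  shows "info_about Y X U = info_about Y X (U \<inter> B)"
proof -
  have T: "simple_function M (tuple Y W)" if "finite W" "W \<subseteq> I" for W
    using that sf(2) by (intro simple_function_tuple) auto
  have TU: "simple_function M (tuple Y U)" "simple_function M (tuple Y (U - B))"
      "simple_function M (tuple Y (U \<inter> B))"
    using U by (auto intro!: T)
  have "\<H>(tuple Y U) = \<H>(\<lambda>\<omega>. (tuple Y (U \<inter> B) \<omega>, tuple Y (U - B) \<omega>))"
    by (rule entropy_cong_levels[OF TU(1)]) (auto simp: tuple_eq_iff)
  also have "\<dots> = \<H>(tuple Y (U \<inter> B)) + \<H>(tuple Y (U - B))"
    by (rule entropy_pair_of_disjoint_tuples[OF ind R, of "U \<inter> B" "U - B"]) (use U TU in auto)
  finally have 1: "\<H>(tuple Y U) = \<dots>" .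
  have "\<H>(\<lambda>\<omega>. (tuple Y U \<omega>, X \<omega>)) = \<H>(\<lambda>\<omega>. ((tuple Y (U \<inter> B) \<omega>, X \<omega>), tuple Y (U - B) \<omega>))"
    by (rule entropy_cong_levels[OF simple_function_Pair[OF TU(1) sf(1)]])
      (auto simp: tuple_eq_iff)
  also have "\<dots> = \<H>(\<lambda>\<omega>. (tuple Y (U \<inter> B) \<omega>, X \<omega>)) + \<H>(tuple Y (U - B))"
    by (rule entropy_pair_of_disjoint_tuples[OF ind R, of B "U - B"])
      (use U B TU sf(1) in \<open>auto simp: tuple_eq_iff intro: det\<close>)
  finally show ?thesis using 1 by (simp add: info_about_def)
qed

end

section \<open>The Shapley value\<close>

text \<open>
The marginal contribution of player \<open>i\<close> when the players join in the order \<open>xs\<close>.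
\<close>
definition gain :: "('i set \<Rightarrow> real) \<Rightarrow> 'i list \<Rightarrow> 'i \<Rightarrow> real" where
  "gain v xs i = v (insert i (set (takeWhile (\<lambda>j. j \<noteq> i) xs))) - v (set (takeWhile (\<lambda>j. j \<noteq> i) xs))"

definition shapley :: "'i set \<Rightarrow> ('i set \<Rightarrow> real) \<Rightarrow> 'i \<Rightarrow> real" where
  "shapley K v i = (\<Sum>xs\<in>permutations_of_set K. gain v xs i) / fact (card K)"

lemma sum_gain: "distinct xs \<Longrightarrow> (\<Sum>i\<in>set xs. gain v xs i) = v (set xs) - v {}"
proof (induction xs rule: rev_induct)
  case (snoc x xs)
  have "(\<Sum>i\<in>set xs. gain v (xs @ [x]) i) = (\<Sum>i\<in>set xs. gain v xs i)"
    by (intro sum.cong refl) (simp add: gain_def takeWhile_append1)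
  moreover have "gain v (xs @ [x]) x = v (insert x (set xs)) - v (set xs)"
    using snoc.prems by (subst gain_def, subst (1 2) takeWhile_append2) auto
  ultimately show ?case using snoc by simp
qed simp

lemma shapley_sum:
  assumes "finite K"
  shows "(\<Sum>i\<in>K. shapley K v i) = v K - v {}"
proof -
  have "(\<Sum>i\<in>K. shapley K v i) = (\<Sum>xs\<in>permutations_of_set K. \<Sum>i\<in>K. gain v xs i) / fact (card K)"
    unfolding shapley_def sum_divide_distrib[symmetric] by (subst sum.swap) simp
  also have "(\<Sum>xs\<in>permutations_of_set K. \<Sum>i\<in>K. gain v xs i) = (\<Sum>xs\<in>permutations_of_set K. v K - v {})"
    using sum_gain by (intro sum.cong refl) (auto simp: permutations_of_set_def)
  finally show ?thesis using assms by simp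
qed

lemma shapley_mono:
  assumes "i \<in> K"
    and le: "\<And>U. U \<subseteq> K \<Longrightarrow> v (insert i U) - v U \<le> v' (insert i U) - v' U"
  shows "shapley K v i \<le> shapley K v' i"
  unfolding shapley_def gain_def
proof (intro divide_right_mono sum_mono le)
  fix xs assume "xs \<in> permutations_of_set K"
  then show "set (takeWhile (\<lambda>j. j \<noteq> i) xs) \<subseteq> K"
    by (auto simp: permutations_of_set_def dest: set_takeWhileD)
qed simp

lemma shapley_cong:
  assumes "i \<in> K" and "\<And>U. U \<subseteq> K \<Longrightarrow> v U = v' U"
  shows "shapley K v i = shapley K v' i"
  using assms by (intro antisym shapley_mono) auto

lemma shapley_null:
  assumes "i \<in> K" and "\<And>U. U \<subseteq> K \<Longrightarrow> v (insert i U) = v U"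
  shows "shapley K v i = 0"
proof -
  have "shapley K v i = shapley K (\<lambda>_. 0) i"
    using assms by (intro antisym shapley_mono) auto
  then show ?thesis by (simp add: shapley_def gain_def)
qed

lemma shapley_nonneg:
  assumes "i \<in> K" and "\<And>U. U \<subseteq> K \<Longrightarrow> v U \<le> v (insert i U)"
  shows "0 \<le> shapley K v i"
proof -
  have "shapley K (\<lambda>_. 0) i \<le> shapley K v i"
    using assms by (intro shapley_mono) auto
  then show ?thesis by (simp add: shapley_def gain_def)
qed

lemma shapley_image:
  assumes inj: "inj_on \<pi> K" and i: "i \<in> K"
  shows "shapley (\<pi> ` K) v (\<pi> i) = shapley K (\<lambda>U. v (\<pi> ` U)) i"
proof -
  have "gain v (map \<pi> xs) (\<pi> i) = gain (\<lambda>U. v (\<pi> ` U)) xs i" if "xs \<in> permutations_of_set K" for xs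
  proof -
    have "takeWhile (\<lambda>j. j \<noteq> \<pi> i) (map \<pi> xs) = map \<pi> (takeWhile (\<lambda>j. j \<noteq> i) xs)"
      unfolding takeWhile_map comp_def
      using that i inj by (intro arg_cong[where f = "map \<pi>"] takeWhile_cong)
        (auto simp: permutations_of_set_def inj_on_eq_iff)
    then show ?thesis by (simp add: gain_def)
  qed
  moreover have "inj_on (map \<pi>) (permutations_of_set K)"
    using inj by (auto simp: permutations_of_set_def inj_on_def[of "map \<pi>"] intro: map_inj_on)
  moreover have "card (\<pi> ` K) = card K" using inj by (rule card_image)
  ultimately show ?thesis
    by (simp add: shapley_def permutations_of_set_image_inj[OF inj] sum.reindex)
qed

lemma inj_extends_to_bij:
  assumes K: "finite K" and B: "B \<subseteq> K" and g: "inj_on g B" "g ` B \<subseteq> K"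
  obtains \<pi> where "bij_betw \<pi> K K" and "\<And>x. x \<in> B \<Longrightarrow> \<pi> x = g x"
proof -
  have fin: "finite B" "finite (g ` B)" using K B g finite_subset by blast+
  have "card (K - B) = card (K - g ` B)"
    using K B g fin by (simp add: card_Diff_subset card_image)
  then obtain h where h: "bij_betw h (K - B) (K - g ` B)"
    using K by (meson bij_betw_iff_card finite_Diff)
  have "bij_betw (\<lambda>x. if x \<in> B then g x else h x) (B \<union> (K - B)) (g ` B \<union> (K - g ` B))"
  proof (rule bij_betw_combine)
    show "bij_betw (\<lambda>x. if x \<in> B then g x else h x) B (g ` B)"
      using g by (auto simp: bij_betw_def inj_on_def)
    show "bij_betw (\<lambda>x. if x \<in> B then g x else h x) (K - B) (K - g ` B)"
      using h by (rule bij_betw_cong[THEN iffD1, rotated]) auto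
  qed auto
  then have "bij_betw (\<lambda>x. if x \<in> B then g x else h x) K K"
    using B g by (simp add: Un_absorb1)
  then show ?thesis by (rule that) simp
qed

text \<open>
A relabelling \<open>g\<close> that matches the supports \<open>B\<close> and \<open>g ` B\<close> of two games matches their Shapley values,
although both values are computed within the same set \<open>K\<close> of players, which \<open>g\<close> need not preserve:
since the players outside the supports are irrelevant, \<open>g\<close> may be replaced by any permutation of
\<open>K\<close> that extends it.
\<close>
lemma shapley_relabel:
  assumes K: "finite K" and B: "B \<subseteq> K" and g: "inj_on g B" "g ` B \<subseteq> K"
    and v: "\<And>U. U \<subseteq> K \<Longrightarrow> v U = v (U \<inter> B)"
    and v': "\<And>U. U \<subseteq> K \<Longrightarrow> v' U = v' (U \<inter> g ` B)"
    and rel: "\<And>U. U \<subseteq> B \<Longrightarrow> v' (g ` U) = v U"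
    and i: "i \<in> B"
  shows "shapley K v' (g i) = shapley K v i"
proof -
  obtain \<pi> where \<pi>: "bij_betw \<pi> K K" "\<And>x. x \<in> B \<Longrightarrow> \<pi> x = g x"
    using inj_extends_to_bij[OF K B g] by blast
  then have img: "\<pi> ` K = K" and inj: "inj_on \<pi> K"
    by (auto simp: bij_betw_def)
  have "v' (\<pi> ` U) = v U" if U: "U \<subseteq> K" for U
  proof -
    have "\<pi> ` U \<inter> g ` B = \<pi> ` U \<inter> \<pi> ` B" using \<pi>(2) by auto
    also have "\<dots> = \<pi> ` (U \<inter> B)" using inj_on_image_Int[OF inj U B] by simp
    also have "\<dots> = g ` (U \<inter> B)" using \<pi>(2) by auto
    finally have eq: "\<pi> ` U \<inter> g ` B = g ` (U \<inter> B)" .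
    have "v' (\<pi> ` U) = v' (\<pi> ` U \<inter> g ` B)"
      using U img by (intro v') blast
    also have "\<dots> = v (U \<inter> B)" unfolding eq by (intro rel) blast
    finally show ?thesis using v[OF U] by simp
  qed
  then have "shapley K (\<lambda>U. v' (\<pi> ` U)) i = shapley K v i"
    using i B by (intro shapley_cong) auto
  then show ?thesis
    using shapley_image[OF inj, of i v'] i B \<pi>(2)[OF i] img by auto
qed

text \<open>
If \<open>w\<close> is the indicator of \<open>W\<close>, then the conclusion is the first hypothesis, because
\<open>max (w x) (w (\<tau> s x))\<close> is the indicator of \<open>W\<close> together with its preimage under \<open>\<tau> s\<close>. The general case is a
superposition of such indicators with nested supports: subtracting the smallest positive value on
the whole support removes one layer, lowers every maximum by the corresponding indicator, and
makes the support smaller.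
\<close>
lemma isoperimetric_layer_cake:
  fixes w :: "'g \<Rightarrow> real" and \<alpha> :: "'s \<Rightarrow> real" and \<beta> :: real and \<tau> :: "'s \<Rightarrow> 'g \<Rightarrow> 'g"
  assumes C: "\<And>W. W \<subseteq> C \<Longrightarrow> W \<noteq> {} \<Longrightarrow> \<beta> * card W \<le> (\<Sum>s\<in>S. \<alpha> s * card (W \<union> {x\<in>K. \<tau> s x \<in> W}))"
    and w: "\<And>x. 0 \<le> w x" "\<And>x. x \<notin> C \<Longrightarrow> w x = 0"
    and fin: "finite K" "C \<subseteq> K"
  shows "\<beta> * (\<Sum>x\<in>K. w x) \<le> (\<Sum>s\<in>S. \<alpha> s * (\<Sum>x\<in>K. max (w x) (w (\<tau> s x))))"
  using w
proof (induction "card {x\<in>C. w x \<noteq> 0}" arbitrary: w rule: less_induct)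
  case (less w)
  define W where "W = {x\<in>C. w x \<noteq> 0}"
  have finC: "finite C" using fin finite_subset by blast
  then have finW: "finite W" by (simp add: W_def)
  have memW: "x \<in> W \<longleftrightarrow> w x \<noteq> 0" for x using less.prems(2) by (auto simp: W_def)
  show ?case
  proof (cases "W = {}")
    case True
    then have "w x = 0" for x using memW by blast
    then show ?thesis by simp
  next
    case False
    define m where "m = Min (w ` W)"
    have m_le: "m \<le> w x" if "x \<in> W" for x
      unfolding m_def using finW that by auto
    have "m \<in> w ` W"
      using finW False by (auto simp: m_def)
    then obtain x0 where x0: "x0 \<in> W" "w x0 = m"
      by auto
    have m_pos: "0 < m" using x0 less.prems(1)[of x0] memW by force
    define w' where "w' x = (if x \<in> W then w x - m else 0)" for x
    have w': "0 \<le> w' x" "x \<notin> C \<Longrightarrow> w' x = 0" for x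
      using m_le by (auto simp: w'_def W_def)
    have "{x\<in>C. w' x \<noteq> 0} \<subseteq> W - {x0}"
      using x0 by (auto simp: w'_def)
    then have "card {x\<in>C. w' x \<noteq> 0} < card W"
      using finW x0(1) by (meson card_Diff1_less card_mono finite_Diff le_less_trans)
    then have IH: "\<beta> * (\<Sum>x\<in>K. w' x) \<le> (\<Sum>s\<in>S. \<alpha> s * (\<Sum>x\<in>K. max (w' x) (w' (\<tau> s x))))"
      using less.hyps[of w'] w' by (simp add: W_def)
    have w_eq: "w x = w' x + m * of_bool (x \<in> W)" for x
      using memW[of x] by (auto simp: w'_def)
    have "max (w x) (w (\<tau> s x)) = max (w' x) (w' (\<tau> s x)) + m * of_bool (x \<in> W \<or> \<tau> s x \<in> W)" for s x
      unfolding w_eq using w'[of x] w'[of "\<tau> s x"] m_pos by (auto simp: w'_def)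
    moreover have "(\<Sum>x\<in>K. of_bool (x \<in> W \<or> \<tau> s x \<in> W)) = real (card (W \<union> {x\<in>K. \<tau> s x \<in> W}))" for s
    proof -
      have "{x \<in> K. x \<in> W \<or> \<tau> s x \<in> W} = W \<union> {x\<in>K. \<tau> s x \<in> W}"
        using fin by (auto simp: W_def)
      then show ?thesis using fin(1) by (simp add: of_bool_def sum.If_cases Int_def)
    qed
    ultimately have R: "(\<Sum>s\<in>S. \<alpha> s * (\<Sum>x\<in>K. max (w x) (w (\<tau> s x)))) =
        (\<Sum>s\<in>S. \<alpha> s * (\<Sum>x\<in>K. max (w' x) (w' (\<tau> s x)))) +
        m * (\<Sum>s\<in>S. \<alpha> s * card (W \<union> {x\<in>K. \<tau> s x \<in> W}))"
      by (simp add: sum.distrib algebra_simps flip: sum_distrib_left sum_distrib_right)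
    have "(\<Sum>x\<in>K. of_bool (x \<in> W)) = real (card W)"
    proof -
      have "{x \<in> K. x \<in> W} = W" using fin by (auto simp: W_def)
      then show ?thesis using fin(1) by (simp add: of_bool_def sum.If_cases Int_def)
    qed
    then have L: "(\<Sum>x\<in>K. w x) = (\<Sum>x\<in>K. w' x) + m * card W"
      unfolding w_eq by (simp add: sum.distrib flip: sum_distrib_left)
    have "\<beta> * card W \<le> (\<Sum>s\<in>S. \<alpha> s * card (W \<union> {x\<in>K. \<tau> s x \<in> W}))"
      using False by (intro C) (auto simp: W_def)
    then have "m * (\<beta> * card W) \<le> m * (\<Sum>s\<in>S. \<alpha> s * card (W \<union> {x\<in>K. \<tau> s x \<in> W}))"
      using m_pos by simp
    then show ?thesis unfolding L R using IH by (simp add: algebra_simps)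
  qed
qed

section \<open>Factors that look at a finite window\<close>

text \<open>
The group acts on configurations with independent entries distributed according to \<open>N\<close>.
\<close>
locale bernoulli_shift = group G for G (structure) +
  fixes N :: "'n measure" and b :: real
  assumes prob_space_N: "prob_space N" and base_gt_1: "1 < b"

sublocale bernoulli_shift \<subseteq> information_space "PiM (carrier G) (\<lambda>_. N)" b
  using prob_space_PiM[of "carrier G" "\<lambda>_. N"] prob_space_N base_gt_1
  by (simp add: information_space_def information_space_axioms_def)

context bernoulli_shift
begin

abbreviation \<Omega> where "\<Omega> \<equiv> PiM (carrier G) (\<lambda>_. N)"

abbreviation shannon (\<open>\<H>'(_')\<close>)
  where "\<H>(X) \<equiv> entropy b (count_space (X ` space \<Omega>)) X"

lemma translate_measurable:
  assumes "g \<in> carrier G"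
  shows "translate G g \<in> measurable \<Omega> \<Omega>"
  unfolding translate_def using assms by (intro measurable_restrict measurable_component_singleton) auto

lemma translate_apply: "g \<in> carrier G \<Longrightarrow> x \<in> carrier G \<Longrightarrow> translate G (inv g) z x = z (g \<otimes> x)"
  by (simp add: translate_def)

text \<open>
A translation permutes identically distributed independent coordinates.
\<close>
lemma distr_translate:
  assumes "g \<in> carrier G"
  shows "distr \<Omega> \<Omega> (translate G g) = \<Omega>"
  using distr_PiM_reindex[of "carrier G" "\<lambda>_. N" "\<lambda>x. inv g \<otimes> x" "carrier G"] prob_space_N assms
  by (simp add: translate_def[abs_def] inj_on_def)

lemma coordinates_indep:
  assumes D: "D \<in> measurable N L"
  shows "indep_vars (\<lambda>_. L) (\<lambda>i z. D (z i)) (carrier G)"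
proof (rule indep_vars_compose2[where M' = "\<lambda>_. N" and Y = "\<lambda>_. D"])
  have "distr \<Omega> \<Omega> (\<lambda>z. \<lambda>i\<in>carrier G. z i) = distr \<Omega> \<Omega> (\<lambda>z. z)"
    by (intro distr_cong) (auto simp: space_PiM)
  then have "distr \<Omega> \<Omega> (\<lambda>z. \<lambda>i\<in>carrier G. z i) = (\<Pi>\<^sub>M i\<in>carrier G. distr \<Omega> N (\<lambda>z. z i))"
    using distr_PiM_component[of "carrier G" "\<lambda>_. N"] prob_space_N by (simp cong: PiM_cong)
  then show "indep_vars (\<lambda>_. N) (\<lambda>i z. z i) (carrier G)"
    by (subst indep_vars_iff_distr_eq_PiM') auto
qed (use D in auto)

text \<open>
Here \<open>f\<close> reads the labels \<open>D (z i)\<close> in the window \<open>B\<close>, and \<open>f (translate G (inv \<sigma>) z)\<close> reads those in the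
translated window \<open>\<sigma>B\<close>. All games are played by the finite set \<open>K\<close>, which contains all these windows.
\<close>
lemma finite_window_inequality:
  fixes f :: "('a \<Rightarrow> 'n) \<Rightarrow> 't" and D :: "'n \<Rightarrow> 'd" and \<alpha> :: "'a \<Rightarrow> real" and \<beta> :: real
  assumes D: "D \<in> measurable N (count_space R)" and R: "finite R"
    and B: "finite B" "B \<subseteq> carrier G"
    and f: "\<And>z z'. z \<in> space \<Omega> \<Longrightarrow> z' \<in> space \<Omega> \<Longrightarrow> \<forall>i\<in>B. D (z i) = D (z' i) \<Longrightarrow> f z = f z'"
    and S: "finite S" "S \<subseteq> carrier G" and \<alpha>: "\<And>\<sigma>. \<sigma> \<in> S \<Longrightarrow> 0 \<le> \<alpha> \<sigma>"
    and \<beta>: "\<And>W. W \<subseteq> carrier G \<Longrightarrow> finite W \<Longrightarrow> W \<noteq> {} \<Longrightarrow>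
        \<beta> * card W \<le> (\<Sum>\<sigma>\<in>S. \<alpha> \<sigma> * card (W \<union> (\<sigma> <# W)))"
  shows "\<beta> * \<H>(f) \<le> (\<Sum>\<sigma>\<in>S. \<alpha> \<sigma> * \<H>(\<lambda>z. (f z, f (translate G (inv \<sigma>) z))))"
proof -
  define Y where "Y i z = D (z i)" for i :: 'a and z :: "'a \<Rightarrow> 'n"
  have ind: "indep_vars (\<lambda>_. count_space R) Y (carrier G)"
    using coordinates_indep[OF D] by (simp add: Y_def[abs_def])
  have Y: "simple_function \<Omega> (Y i)" if "i \<in> carrier G" for i
    using ind that R by (intro simple_function_finite_codomain[where R = R]) (auto simp: indep_vars_def)
  have tup: "simple_function \<Omega> (tuple Y U)" if "finite U" "U \<subseteq> carrier G" for U
    using that Y by (intro simple_function_tuple) auto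
  have fdet: "f z = f z'" if "z \<in> space \<Omega>" "z' \<in> space \<Omega>" "\<forall>i\<in>B. Y i z = Y i z'" for z z'
    using that by (intro f) (auto simp: Y_def)
  have sf: "simple_function \<Omega> f"
    using tup[OF B] by (rule simple_function_determined) (auto simp: tuple_eq_iff intro: fdet)
  let ?T = "\<lambda>\<sigma>. translate G (inv \<sigma>)"
  let ?s = "\<lambda>\<sigma>. (\<otimes>) \<sigma>"
  have sB: "?s \<sigma> ` B \<subseteq> carrier G" "finite (?s \<sigma> ` B)" "inj_on (?s \<sigma>) B" if "\<sigma> \<in> S" for \<sigma>
    using that B S by (auto simp: inj_on_def) (metis Units_eq Units_l_cancel subsetD)
  have T: "?T \<sigma> \<in> measurable \<Omega> \<Omega>" "distr \<Omega> \<Omega> (?T \<sigma>) = \<Omega>" if "\<sigma> \<in> S" for \<sigma>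
    using that S translate_measurable[of "inv \<sigma>"] distr_translate[of "inv \<sigma>"] by auto
  have YT: "Y i (?T \<sigma> z) = Y (\<sigma> \<otimes> i) z" if "\<sigma> \<in> S" "i \<in> carrier G" for \<sigma> i z
    using that S by (auto simp: Y_def translate_apply)
  have fTdet: "f (?T \<sigma> z) = f (?T \<sigma> z')"
    if \<sigma>: "\<sigma> \<in> S" and z: "z \<in> space \<Omega>" "z' \<in> space \<Omega>" and eq: "\<forall>i\<in>?s \<sigma> ` B. Y i z = Y i z'" for \<sigma> z z'
    using eq B S \<sigma> by (intro fdet measurable_space[OF T(1)[OF \<sigma>]] z) (auto simp: YT subset_iff)
  have sfT: "simple_function \<Omega> (\<lambda>z. f (?T \<sigma> z))" if "\<sigma> \<in> S" for \<sigma>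
    using tup[OF sB(2,1)[OF that]]
    by (rule simple_function_determined) (auto simp: tuple_eq_iff intro!: fTdet[OF that])
  \<comment> \<open>The games of \<open>X\<^sub>e\<close>, of \<open>X\<^sub>\<sigma>\<close> and of the pair \<open>(X\<^sub>e, X\<^sub>\<sigma>)\<close>.\<close>
  define v where "v = info_about Y f"
  define vs where "vs \<sigma> = info_about Y (\<lambda>z. f (?T \<sigma> z))" for \<sigma>
  define us where "us \<sigma> = info_about Y (\<lambda>z. (f z, f (?T \<sigma> z)))" for \<sigma>
  define K where "K = B \<union> (\<Union>\<sigma>\<in>S. ?s \<sigma> ` B)"
  have K: "finite K" "K \<subseteq> carrier G" "B \<subseteq> K" "\<And>\<sigma>. \<sigma> \<in> S \<Longrightarrow> ?s \<sigma> ` B \<subseteq> K"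
    using B S sB by (auto simp: K_def)
  have finK: "finite U" "U \<subseteq> carrier G" if "U \<subseteq> K" for U
    using that K finite_subset by auto
  have YK: "simple_function \<Omega> (Y i)" if "i \<in> insert x U" "x \<in> K" "U \<subseteq> K" for i x U
    using that K(2) by (intro Y) blast
  have v_restrict: "v U = v (U \<inter> B)" if "U \<subseteq> K" for U
    unfolding v_def by (rule info_about_restrict[OF ind R finK[OF that] B _ sf Y]) (rule fdet)
  have vs_restrict: "vs \<sigma> U = vs \<sigma> (U \<inter> ?s \<sigma> ` B)" if "\<sigma> \<in> S" "U \<subseteq> K" for \<sigma> U
    unfolding vs_def
    by (rule info_about_restrict[OF ind R finK[OF that(2)] sB(2,1)[OF that(1)] _ sfT[OF that(1)] Y])
      (rule fTdet[OF that(1)])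
  have vs_shift: "vs \<sigma> (?s \<sigma> ` U) = v U" if \<sigma>: "\<sigma> \<in> S" and U: "U \<subseteq> B" for \<sigma> U
  proof -
    have U': "finite U" "U \<subseteq> carrier G" using U B finite_subset by auto
    have sU: "simple_function \<Omega> (tuple Y (?s \<sigma> ` U))"
      using U' S \<sigma> by (intro tup) auto
    have lev: "tuple Y (?s \<sigma> ` U) z = tuple Y (?s \<sigma> ` U) z' \<longleftrightarrow> tuple Y U (?T \<sigma> z) = tuple Y U (?T \<sigma> z')" for z z'
      using U' \<sigma> by (auto simp: tuple_eq_iff YT subset_iff)
    have "\<H>(tuple Y (?s \<sigma> ` U)) = \<H>(\<lambda>z. tuple Y U (?T \<sigma> z))"
      by (rule entropy_cong_levels[OF sU]) (rule lev)
    also have "\<dots> = \<H>(tuple Y U)"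
      by (rule entropy_measure_preserving[OF tup[OF U'] T[OF \<sigma>]])
    finally have 1: "\<H>(tuple Y (?s \<sigma> ` U)) = \<H>(tuple Y U)" .
    have "\<H>(\<lambda>z. (tuple Y (?s \<sigma> ` U) z, f (?T \<sigma> z))) = \<H>(\<lambda>z. (tuple Y U (?T \<sigma> z), f (?T \<sigma> z)))"
      by (rule entropy_cong_levels[OF simple_function_Pair[OF sU sfT[OF \<sigma>]]]) (simp add: lev)
    also have "\<dots> = \<H>(\<lambda>z. (tuple Y U z, f z))"
      by (rule entropy_measure_preserving[OF simple_function_Pair[OF tup[OF U'] sf] T[OF \<sigma>]])
    finally show ?thesis
      using 1 entropy_measure_preserving[OF sf T[OF \<sigma>]] by (simp add: v_def vs_def info_about_def)
  qed
  \<comment> \<open>Zero outside \<open>K\<close>, so that \<open>w (inv \<sigma> \<otimes> x)\<close> makes sense even if \<open>inv \<sigma> \<otimes> x\<close> leaves \<open>K\<close>.\<close>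
  define w where "w x = (if x \<in> K then shapley K v x else 0)" for x
  have w_nonneg: "0 \<le> w x" for x
    by (auto simp: w_def v_def intro!: shapley_nonneg info_about_gain_nonneg YK sf finK(1))
  have w_outside: "w x = 0" if "x \<notin> B" for x
  proof (cases "x \<in> K")
    case True
    have "v (insert x U) = v U" if "U \<subseteq> K" for U
      using v_restrict[of "insert x U"] v_restrict[OF that] that True \<open>x \<notin> B\<close> by simp
    then show ?thesis using True by (simp add: w_def shapley_null)
  qed (simp add: w_def)
  have w_shift: "shapley K (vs \<sigma>) x = w (inv \<sigma> \<otimes> x)" if \<sigma>: "\<sigma> \<in> S" and x: "x \<in> K" for \<sigma> x
  proof (cases "x \<in> ?s \<sigma> ` B")
    case True
    then obtain y where y: "y \<in> B" "x = \<sigma> \<otimes> y" by auto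
    then have "inv \<sigma> \<otimes> x = y"
      using \<sigma> S B by (auto simp: m_assoc[symmetric] subset_iff)
    moreover have "shapley K (vs \<sigma>) (\<sigma> \<otimes> y) = shapley K v y"
      by (rule shapley_relabel[OF K(1,3) sB(3)[OF \<sigma>] K(4)[OF \<sigma>] v_restrict vs_restrict[OF \<sigma>] vs_shift[OF \<sigma>] y(1)])
    ultimately show ?thesis using y K by (auto simp: w_def)
  next
    case False
    have "vs \<sigma> (insert x U) = vs \<sigma> U" if "U \<subseteq> K" for U
      using vs_restrict[OF \<sigma>, of "insert x U"] vs_restrict[OF \<sigma> that] that x False by simp
    then have "shapley K (vs \<sigma>) x = 0" using x by (intro shapley_null)
    moreover have "inv \<sigma> \<otimes> x \<notin> B"
    proof
      assume "inv \<sigma> \<otimes> x \<in> B"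
      moreover have "x = \<sigma> \<otimes> (inv \<sigma> \<otimes> x)"
        using \<sigma> S x K by (simp add: m_assoc[symmetric] subset_iff)
      ultimately show False using False by blast
    qed
    ultimately show ?thesis by (simp add: w_outside)
  qed
  have edge: "(\<Sum>x\<in>K. max (w x) (w (inv \<sigma> \<otimes> x))) \<le> \<H>(\<lambda>z. (f z, f (?T \<sigma> z)))" if \<sigma>: "\<sigma> \<in> S" for \<sigma>
  proof -
    have sfp: "simple_function \<Omega> (\<lambda>z. (f z, f (?T \<sigma> z)))"
      using sf sfT[OF \<sigma>] by (rule simple_function_Pair)
    have "max (w x) (w (inv \<sigma> \<otimes> x)) \<le> shapley K (us \<sigma>) x" if x: "x \<in> K" for x
    proof -
      have "shapley K v x \<le> shapley K (us \<sigma>) x"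
        unfolding v_def us_def using x
        by (intro shapley_mono info_about_gain_mono sfp YK finK(1)) auto
      moreover have "shapley K (vs \<sigma>) x \<le> shapley K (us \<sigma>) x"
        unfolding vs_def us_def using x
        by (intro shapley_mono info_about_gain_mono sfp YK finK(1)) auto
      ultimately show ?thesis using w_shift[OF \<sigma> x] x by (simp add: w_def)
    qed
    then have "(\<Sum>x\<in>K. max (w x) (w (inv \<sigma> \<otimes> x))) \<le> (\<Sum>x\<in>K. shapley K (us \<sigma>) x)"
      by (rule sum_mono)
    also have "\<dots> = us \<sigma> K - us \<sigma> {}" by (rule shapley_sum[OF K(1)])
    also have "us \<sigma> {} = 0" unfolding us_def by (rule info_about_empty[OF sfp])
    also have "us \<sigma> K = \<H>(\<lambda>z. (f z, f (?T \<sigma> z)))"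
      unfolding us_def
    proof (rule info_about_determined[OF tup[OF K(1,2)]])
      fix z z' assume z: "z \<in> space \<Omega>" "z' \<in> space \<Omega>" "\<forall>i\<in>K. Y i z = Y i z'"
      then show "(f z, f (?T \<sigma> z)) = (f z', f (?T \<sigma> z'))"
        using fdet[OF z(1,2)] fTdet[OF \<sigma> z(1,2)] K(3) K(4)[OF \<sigma>] by blast
    qed
    finally show ?thesis by simp
  qed
  have vertex: "(\<Sum>x\<in>K. w x) = \<H>(f)"
  proof -
    have "(\<Sum>x\<in>K. w x) = v K - v {}" using shapley_sum[OF K(1)] by (simp add: w_def)
    also have "v {} = 0" unfolding v_def by (rule info_about_empty[OF sf])
    also have "v K = \<H>(f)"
      unfolding v_def by (rule info_about_determined[OF tup[OF K(1,2)]]) (use fdet K(3) in blast)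
    finally show ?thesis by simp
  qed
  have "\<beta> * (\<Sum>x\<in>K. w x) \<le> (\<Sum>\<sigma>\<in>S. \<alpha> \<sigma> * (\<Sum>x\<in>K. max (w x) (w (inv \<sigma> \<otimes> x))))"
  proof (rule isoperimetric_layer_cake[where C = B])
    fix W assume W: "W \<subseteq> B" "W \<noteq> {}"
    have "{x\<in>K. inv \<sigma> \<otimes> x \<in> W} = \<sigma> <# W" if \<sigma>: "\<sigma> \<in> S" for \<sigma>
    proof (intro equalityI subsetI)
      fix x assume x: "x \<in> {x\<in>K. inv \<sigma> \<otimes> x \<in> W}"
      then have "x = \<sigma> \<otimes> (inv \<sigma> \<otimes> x)"
        using \<sigma> S K by (simp add: m_assoc[symmetric] subset_iff)
      then show "x \<in> \<sigma> <# W" using x unfolding l_coset_def by blast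
    next
      fix x assume "x \<in> \<sigma> <# W"
      then obtain y where "y \<in> W" "x = \<sigma> \<otimes> y" by (auto simp: l_coset_def)
      then show "x \<in> {x\<in>K. inv \<sigma> \<otimes> x \<in> W}"
        using W \<sigma> S B K(4)[OF \<sigma>] by (auto simp: m_assoc[symmetric] subset_iff)
    qed
    then show "\<beta> * card W \<le> (\<Sum>\<sigma>\<in>S. \<alpha> \<sigma> * card (W \<union> {x\<in>K. inv \<sigma> \<otimes> x \<in> W}))"
      using \<beta>[of W] W B finite_subset[OF W(1) B(1)] by auto
  qed (use w_nonneg w_outside K in auto)
  also have "\<dots> \<le> (\<Sum>\<sigma>\<in>S. \<alpha> \<sigma> * \<H>(\<lambda>z. (f z, f (?T \<sigma> z))))"
    using edge \<alpha> by (intro sum_mono mult_left_mono) auto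
  finally show ?thesis unfolding vertex .
qed

end

section \<open>Approximation of measurable factors by finite windows\<close>

text \<open>
The only delicate point is \<open>0\<close>, where the value \<open>0 * log b 0 = 0\<close> is the right limit.
\<close>
lemma continuous_on_mult_log:
  assumes "1 < (b::real)"
  shows "continuous_on {0..} (\<lambda>x. x * log b x)"
proof -
  have lim: "((\<lambda>x::real. x * ln x) \<longlongrightarrow> 0) (at_right 0)"
    by real_asymp
  have "continuous (at x within {0..}) (\<lambda>x. x * ln x)" if "0 \<le> x" for x :: real
  proof (cases "x = 0")
    case True
    show ?thesis
      unfolding True continuous_within at_within_Ici_at_right mult_zero_left by (rule lim)
  next
    case False
    then show ?thesis
      by (rule continuous_at_imp_continuous_at_within[OF isCont_mult[OF continuous_ident isCont_ln]])
  qed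
  then have "continuous_on {0..} (\<lambda>x::real. x * ln x)"
    by (auto simp: continuous_on_eq_continuous_within)
  then have "continuous_on {0..} (\<lambda>x. x * ln x / ln b)"
    using assms by (intro continuous_on_divide) auto
  then show ?thesis by (simp add: log_def)
qed

text \<open>
Each point probability changes by at most the probability that the two variables differ, and the
entropy is a continuous function of the finitely many point probabilities.
\<close>
lemma (in information_space) entropy_tendsto:
  assumes X: "simple_function M X" "X ` space M \<subseteq> A" and A: "finite A"
    and Xn: "\<And>n. simple_function M (Xn n)" "\<And>n. Xn n ` space M \<subseteq> A"
    and lim: "(\<lambda>n. prob {\<omega>\<in>space M. Xn n \<omega> \<noteq> X \<omega>}) \<longlonglongrightarrow> 0"
  shows "(\<lambda>n. \<H>(Xn n)) \<longlonglongrightarrow> \<H>(X)"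
proof -
  have "(\<lambda>n. prob (Xn n -` {a} \<inter> space M)) \<longlonglongrightarrow> prob (X -` {a} \<inter> space M)" for a
  proof (rule LIM_zero_cancel, rule tendsto_rabs_zero_cancel,
      rule tendsto_sandwich[OF _ _ tendsto_const lim])
    have "\<bar>prob (Xn n -` {a} \<inter> space M) - prob (X -` {a} \<inter> space M)\<bar>
        \<le> prob {\<omega>\<in>space M. Xn n \<omega> \<noteq> X \<omega>}" for n
    proof -
      let ?N = "{\<omega>\<in>space M. Xn n \<omega> \<noteq> X \<omega>}"
      have sets: "Xn n -` {a} \<inter> space M \<in> events" "X -` {a} \<inter> space M \<in> events"
        using X Xn by (auto dest: simple_functionD)
      have N: "?N \<in> events"
        using Xn(1) X(1) by (rule sets_simple_function_neq)
      have "prob (Xn n -` {a} \<inter> space M) \<le> prob ((X -` {a} \<inter> space M) \<union> ?N)"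
        using sets N by (intro finite_measure_mono) auto
      also have "\<dots> \<le> prob (X -` {a} \<inter> space M) + prob ?N"
        using sets N by (intro measure_Un_le) auto
      finally have 1: "prob (Xn n -` {a} \<inter> space M) \<le> prob (X -` {a} \<inter> space M) + prob ?N" .
      have "prob (X -` {a} \<inter> space M) \<le> prob ((Xn n -` {a} \<inter> space M) \<union> ?N)"
        using sets N by (intro finite_measure_mono) auto
      also have "\<dots> \<le> prob (Xn n -` {a} \<inter> space M) + prob ?N"
        using sets N by (intro measure_Un_le) auto
      finally show ?thesis using 1 by linarith
    qed
    then show "\<forall>\<^sub>F n in sequentially. \<bar>prob (Xn n -` {a} \<inter> space M) - prob (X -` {a} \<inter> space M)\<bar>
        \<le> prob {\<omega>\<in>space M. Xn n \<omega> \<noteq> X \<omega>}" by simp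
  qed simp
  then have "(\<lambda>n. \<Sum>a\<in>A. - (prob (Xn n -` {a} \<inter> space M) * log b (prob (Xn n -` {a} \<inter> space M))))
      \<longlonglongrightarrow> (\<Sum>a\<in>A. - (prob (X -` {a} \<inter> space M) * log b (prob (X -` {a} \<inter> space M))))"
    by (intro tendsto_sum tendsto_minus continuous_on_tendsto_compose[OF continuous_on_mult_log[OF b_gt_1]])
      auto
  then show ?thesis
    using X A Xn by (simp add: entropy_finite_codomain flip: entropy_enlarge_codomain[where A = A])
qed

context bernoulli_shift
begin

text \<open>
An event that can be decided by asking, for each of the finitely many coordinates in \<open>B\<close>, which of
the finitely many sets in \<open>\<D>\<close> contain it. Keeping \<open>B\<close> and \<open>\<D>\<close> as parameters lets finitely many
such events share them, by taking unions.
\<close>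
definition window_event :: "'a set \<Rightarrow> 'n set set \<Rightarrow> ('a \<Rightarrow> 'n) set \<Rightarrow> bool"
  where "window_event B \<D> E \<longleftrightarrow> finite B \<and> B \<subseteq> carrier G \<and> finite \<D> \<and> \<D> \<subseteq> sets N \<and> E \<in> events \<and>
    (\<forall>z\<in>space \<Omega>. \<forall>z'\<in>space \<Omega>. (\<forall>i\<in>B. \<forall>D\<in>\<D>. z i \<in> D \<longleftrightarrow> z' i \<in> D) \<longrightarrow> (z \<in> E \<longleftrightarrow> z' \<in> E))"

lemma window_event_mono:
  assumes "window_event B \<D> E" "B \<subseteq> B'" "\<D> \<subseteq> \<D>'" "finite B'" "B' \<subseteq> carrier G" "finite \<D>'" "\<D>' \<subseteq> sets N"
  shows "window_event B' \<D>' E"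
  unfolding window_event_def
proof (intro conjI ballI impI)
  fix z z' assume "z \<in> space \<Omega>" "z' \<in> space \<Omega>" "\<forall>i\<in>B'. \<forall>D\<in>\<D>'. z i \<in> D \<longleftrightarrow> z' i \<in> D"
  then show "z \<in> E \<longleftrightarrow> z' \<in> E"
    using assms(1-3) unfolding window_event_def by blast
qed (use assms in \<open>auto simp: window_event_def\<close>)

lemma finite_window_events:
  assumes "finite J" and "\<And>j. j \<in> J \<Longrightarrow> window_event (B j) (\<D> j) (E j)" and "j \<in> J"
  shows "window_event (\<Union>j\<in>J. B j) (\<Union>j\<in>J. \<D> j) (E j)"
proof (rule window_event_mono[OF assms(2)[OF assms(3)]])
  have "finite (B i)" "B i \<subseteq> carrier G" "finite (\<D> i)" "\<D> i \<subseteq> sets N" if "i \<in> J" for i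
    using assms(2)[OF that] by (simp_all add: window_event_def)
  then show "finite (\<Union>j\<in>J. B j)" "(\<Union>j\<in>J. B j) \<subseteq> carrier G"
      "finite (\<Union>j\<in>J. \<D> j)" "(\<Union>j\<in>J. \<D> j) \<subseteq> sets N"
    using assms(1) by blast+
qed (use assms(3) in blast)+

text \<open>
The events that can be approximated contain the one-coordinate cylinders, are closed under
complements, and are closed under countable unions, since a countable union is exhausted up to small
probability by a finite one. As the cylinders generate the product sigma-algebra, every event can be
approximated.
\<close>
lemma window_event_approximation:
  assumes "E \<in> events" and "0 < \<epsilon>"
  shows "\<exists>B \<D> E'. window_event B \<D> E' \<and> prob (sym_diff E E') < \<epsilon>"
proof -
  have "E \<in> sigma_sets (\<Pi>\<^sub>E i\<in>carrier G. space N)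
      {{f\<in>\<Pi>\<^sub>E i\<in>carrier G. space N. f i \<in> D} | i D. i \<in> carrier G \<and> D \<in> sets N}"
    using assms(1) by (simp add: sets_PiM_single)
  then have "\<forall>\<epsilon>>0. \<exists>B \<D> E'. window_event B \<D> E' \<and> prob (sym_diff E E') < \<epsilon>"
  proof (induction E rule: sigma_sets.induct)
    case (Basic E)
    then obtain i D where E: "E = {f\<in>space \<Omega>. f i \<in> D}" and i: "i \<in> carrier G" and D: "D \<in> sets N"
      by (auto simp: space_PiM)
    have "E \<in> events" unfolding E using i D by measurable
    then have "window_event {i} {D} E"
      using i D by (auto simp: window_event_def E)
    then show ?case by (intro allI impI exI[of _ "{i}"] exI[of _ "{D}"] exI[of _ E]) simp
  next
    case Empty
    have "window_event {} {} {}" by (simp add: window_event_def)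
    then show ?case by (intro allI impI exI[of _ "{}"]) simp
  next
    case (Compl E)
    show ?case
    proof (intro allI impI)
      fix \<epsilon> :: real assume "0 < \<epsilon>"
      then obtain B \<D> E' where E': "window_event B \<D> E'" "prob (sym_diff E E') < \<epsilon>"
        using Compl.IH by blast
      have sub: "E' \<subseteq> space \<Omega>" using E'(1) sets.sets_into_space by (auto simp: window_event_def)
      have "E \<in> events" using Compl.hyps by (simp add: sets_PiM_single)
      then have "E \<subseteq> space \<Omega>" by (rule sets.sets_into_space)
      with sub have "sym_diff (space \<Omega> - E) (space \<Omega> - E') = sym_diff E E'"
        by auto
      moreover have "window_event B \<D> (space \<Omega> - E')"
        using E'(1) unfolding window_event_def by (intro conjI; blast)
      moreover have "(\<Pi>\<^sub>E i\<in>carrier G. space N) = space \<Omega>"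
        by (simp add: space_PiM)
      ultimately show "\<exists>B \<D> E'. window_event B \<D> E' \<and>
          prob (sym_diff (Pi\<^sub>E (carrier G) (\<lambda>i. space N) - E) E') < \<epsilon>"
        using E'(2) by (intro exI[of _ B] exI[of _ \<D>] exI[of _ "space \<Omega> - E'"]) simp
    qed
  next
    case (Union A)
    have A: "A n \<in> events" for n using Union.hyps by (simp add: sets_PiM_single)
    show ?case
    proof (intro allI impI)
      fix \<epsilon> :: real assume \<epsilon>: "0 < \<epsilon>"
      have "(\<lambda>n. prob (\<Union>i<n. A i)) \<longlonglongrightarrow> prob (\<Union>n. \<Union>i<n. A i)"
        using A by (intro finite_Lim_measure_incseq) (auto simp: incseq_def intro: order_less_le_trans)
      also have "(\<Union>n. \<Union>i<n. A i) = (\<Union>i. A i)" by blast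
      finally have "\<forall>\<^sub>F n in sequentially. prob (\<Union>i. A i) - \<epsilon> / 2 < prob (\<Union>i<n. A i)"
        using \<epsilon> by (intro order_tendstoD(1)) auto
      then obtain n where n: "prob (\<Union>i. A i) - \<epsilon> / 2 < prob (\<Union>i<n. A i)"
        by (auto simp: eventually_sequentially)
      \<comment> \<open>Half of \<open>\<epsilon>\<close> pays for the tail of the union, the other half is shared by the first \<open>n\<close> events;
        with \<open>n + 1\<close> in place of \<open>n\<close>, since \<open>n\<close> may be zero.\<close>
      define \<delta> where "\<delta> = \<epsilon> / (2 * (real n + 1))"
      have \<delta>: "0 < \<delta>" "real n * \<delta> \<le> \<epsilon> / 2"
        using \<epsilon> by (auto simp: \<delta>_def field_simps)
      define approx where "approx i B \<D> E' \<longleftrightarrow> window_event B \<D> E' \<and> prob (sym_diff (A i) E') < \<delta>"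
        for i B \<D> E'
      have "\<forall>i. \<exists>B \<D> E'. approx i B \<D> E'"
        unfolding approx_def using Union.IH \<delta>(1) by blast
      then obtain B \<D> E' where "\<And>i. approx i (B i) (\<D> i) (E' i)"
        by metis
      then have E': "\<And>i. window_event (B i) (\<D> i) (E' i)"
          and small: "\<And>i. prob (sym_diff (A i) (E' i)) < \<delta>"
        unfolding approx_def by blast+
      have E'_events: "E' i \<in> events" for i using E'[of i] by (simp add: window_event_def)
      let ?B = "\<Union>i<n. B i" and ?D = "\<Union>i<n. \<D> i" and ?E = "\<Union>i<n. E' i"
      have win: "window_event ?B ?D (E' i)" if "i < n" for i
        by (rule finite_window_events) (use E' that in auto)
      have "window_event ?B ?D ?E"
        unfolding window_event_def
      proof (intro conjI)
        show "?E \<in> events" using E'_events by auto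
        show "\<forall>z\<in>space \<Omega>. \<forall>z'\<in>space \<Omega>. (\<forall>i\<in>?B. \<forall>D\<in>?D. z i \<in> D \<longleftrightarrow> z' i \<in> D) \<longrightarrow> (z \<in> ?E \<longleftrightarrow> z' \<in> ?E)"
        proof (intro ballI impI)
          fix z z' assume "z \<in> space \<Omega>" "z' \<in> space \<Omega>" "\<forall>i\<in>?B. \<forall>D\<in>?D. z i \<in> D \<longleftrightarrow> z' i \<in> D"
          then have "z \<in> E' i \<longleftrightarrow> z' \<in> E' i" if "i < n" for i
            using win[OF that] unfolding window_event_def by blast
          then show "z \<in> ?E \<longleftrightarrow> z' \<in> ?E" by blast
        qed
        show "finite ?B" "?B \<subseteq> carrier G" "finite ?D" "?D \<subseteq> sets N"
          using E' unfolding window_event_def by blast+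
      qed
      moreover have "prob (sym_diff (\<Union>i. A i) ?E) < \<epsilon>"
      proof -
        let ?S = "\<lambda>i. sym_diff (A i) (E' i)"
        have "prob (sym_diff (\<Union>i. A i) ?E)
            \<le> prob (((\<Union>i. A i) - (\<Union>i<n. A i)) \<union> (\<Union>i<n. ?S i))"
          using A E'_events by (intro finite_measure_mono) auto
        also have "\<dots> \<le> prob ((\<Union>i. A i) - (\<Union>i<n. A i)) + prob (\<Union>i<n. ?S i)"
          using A E'_events by (intro measure_Un_le) auto
        also have "prob ((\<Union>i. A i) - (\<Union>i<n. A i)) = prob (\<Union>i. A i) - prob (\<Union>i<n. A i)"
          using A by (intro finite_measure_Diff) auto
        also have "prob (\<Union>i<n. ?S i) \<le> (\<Sum>i<n. prob (?S i))"
          using A E'_events by (intro finite_measure_subadditive_finite) auto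
        also have "(\<Sum>i<n. prob (?S i)) \<le> (\<Sum>i<n. \<delta>)"
          using small by (intro sum_mono) (simp add: less_imp_le)
        finally show ?thesis using n \<delta>(2) by simp
      qed
      ultimately show "\<exists>B \<D> E'. window_event B \<D> E' \<and> prob (sym_diff (\<Union>i. A i) E') < \<epsilon>"
        by blast
    qed
  qed
  then show ?thesis using assms(2) by blast
qed

text \<open>
Approximate each level set \<open>{f = a}\<close> by a window event \<open>E a\<close>, and let \<open>f'\<close> pick some \<open>a\<close> whose event
contains the configuration. Where \<open>f'\<close> differs from \<open>f\<close>, one of the events \<open>E a\<close> disagrees with the level
set that it approximates.
\<close>
lemma window_function_approximation:
  assumes f: "f \<in> measurable \<Omega> (count_space A)" and A: "finite A" and \<epsilon>: "0 < \<epsilon>"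
  obtains B \<D> f' where "finite B" "B \<subseteq> carrier G" "finite \<D>" "\<D> \<subseteq> sets N"
    "\<And>z z'. z \<in> space \<Omega> \<Longrightarrow> z' \<in> space \<Omega> \<Longrightarrow> \<forall>i\<in>B. {D\<in>\<D>. z i \<in> D} = {D\<in>\<D>. z' i \<in> D} \<Longrightarrow> f' z = f' z'"
    "f' ` space \<Omega> \<subseteq> A" "prob {z\<in>space \<Omega>. f' z \<noteq> f z} < \<epsilon>"
proof -
  obtain z0 where "z0 \<in> space \<Omega>" using not_empty by blast
  then have a0: "f z0 \<in> A" using f by (auto dest: measurable_space)
  then have card: "0 < card A" using A by (auto simp: card_gt_0_iff)
  have ev: "{z\<in>space \<Omega>. f z = a} \<in> events" if "a \<in> A" for a
    using measurable_sets[OF f, of "{a}"] that by (simp add: vimage_def Int_def conj_commute)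
  define approx where "approx a B \<D> E \<longleftrightarrow> window_event B \<D> E \<and>
      prob (sym_diff {z\<in>space \<Omega>. f z = a} E) < \<epsilon> / card A" for a B \<D> E
  have "\<forall>a\<in>A. \<exists>B \<D> E. approx a B \<D> E"
    unfolding approx_def using window_event_approximation ev \<epsilon> card by simp
  then obtain B \<D> E where "\<And>a. a \<in> A \<Longrightarrow> approx a (B a) (\<D> a) (E a)"
    by metis
  then have E: "\<And>a. a \<in> A \<Longrightarrow> window_event (B a) (\<D> a) (E a)"
    and small: "\<And>a. a \<in> A \<Longrightarrow> prob (sym_diff {z\<in>space \<Omega>. f z = a} (E a)) < \<epsilon> / card A"
    unfolding approx_def by blast+
  let ?B = "\<Union>a\<in>A. B a" and ?D = "\<Union>a\<in>A. \<D> a"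
  let ?S = "\<lambda>a. sym_diff {z\<in>space \<Omega>. f z = a} (E a)"
  have win: "window_event ?B ?D (E a)" if "a \<in> A" for a
    by (rule finite_window_events[OF A _ that]) (rule E)
  define f' where "f' z = (if \<exists>a\<in>A. z \<in> E a then SOME a. a \<in> A \<and> z \<in> E a else f z0)" for z
  have some: "f' z \<in> A \<and> z \<in> E (f' z)" if "a \<in> A" "z \<in> E a" for a z
    using that someI[of "\<lambda>a. a \<in> A \<and> z \<in> E a" a] by (auto simp: f'_def)
  show thesis
  proof (rule that[of ?B ?D f'])
    show "finite ?B" "?B \<subseteq> carrier G" "finite ?D" "?D \<subseteq> sets N"
      using win[OF a0] by (auto simp: window_event_def)
    show "f' ` space \<Omega> \<subseteq> A"
    proof (intro image_subsetI)
      fix z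
      show "f' z \<in> A"
        using some a0 by (cases "\<exists>a\<in>A. z \<in> E a") (blast, simp add: f'_def)
    qed
    fix z z' assume z: "z \<in> space \<Omega>" "z' \<in> space \<Omega>"
      and eq: "\<forall>i\<in>?B. {D\<in>?D. z i \<in> D} = {D\<in>?D. z' i \<in> D}"
    have same: "a \<in> A \<and> z \<in> E a \<longleftrightarrow> a \<in> A \<and> z' \<in> E a" for a
      using win[of a] z eq unfolding window_event_def by blast
    then have "(\<exists>a\<in>A. z \<in> E a) \<longleftrightarrow> (\<exists>a\<in>A. z' \<in> E a)"
      by blast
    then show "f' z = f' z'"
      unfolding f'_def same by simp
  next
    have S: "?S a \<in> events" if "a \<in> A" for a
      using ev[OF that] E[OF that] by (auto simp: window_event_def)
    have "{z\<in>space \<Omega>. f' z \<noteq> f z} \<subseteq> (\<Union>a\<in>A. ?S a)"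
    proof
      fix z assume "z \<in> {z\<in>space \<Omega>. f' z \<noteq> f z}"
      then have z: "z \<in> space \<Omega>" "f' z \<noteq> f z" by auto
      have fz: "f z \<in> A" using measurable_space[OF f z(1)] by simp
      show "z \<in> (\<Union>a\<in>A. ?S a)"
      proof (cases "z \<in> E (f z)")
        case True
        from some[OF fz this] z show ?thesis by (intro UN_I[of "f' z"]) auto
      next
        case False
        with z fz show ?thesis by (intro UN_I[of "f z"]) auto
      qed
    qed
    then have "prob {z\<in>space \<Omega>. f' z \<noteq> f z} \<le> prob (\<Union>a\<in>A. ?S a)"
      using S A by (intro finite_measure_mono) auto
    also have "\<dots> \<le> (\<Sum>a\<in>A. prob (?S a))"
      using S A by (intro finite_measure_subadditive_finite) auto
    also have "\<dots> < (\<Sum>a\<in>A. \<epsilon> / card A)"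
      using A a0 small by (intro sum_strict_mono) auto
    also have "\<dots> = \<epsilon>" using card by simp
    finally show "prob {z\<in>space \<Omega>. f' z \<noteq> f z} < \<epsilon>" .
  qed
qed

text \<open>
The finite-valued label of a single coordinate to which the finite window case applies: the members
of \<open>\<D>\<close> that contain it.
\<close>
lemma pattern_measurable:
  assumes "finite \<D>" "\<D> \<subseteq> sets N"
  shows "(\<lambda>x. {D\<in>\<D>. x \<in> D}) \<in> measurable N (count_space (Pow \<D>))"
proof (subst measurable_count_space_eq2, use assms in simp, intro conjI ballI)
  fix r assume "r \<in> Pow \<D>"
  then have "(\<lambda>x. {D\<in>\<D>. x \<in> D}) -` {r} \<inter> space N = {x\<in>space N. \<forall>D\<in>\<D>. x \<in> D \<longleftrightarrow> D \<in> r}"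
    by auto
  also have "\<dots> \<in> sets N"
  proof (rule sets.sets_Collect_finite_All[OF _ assms(1)])
    fix D assume "D \<in> \<D>"
    then have [measurable]: "D \<in> sets N" using assms by blast
    show "{x \<in> space N. x \<in> D \<longleftrightarrow> D \<in> r} \<in> sets N" by measurable
  qed
  finally show "(\<lambda>x. {D\<in>\<D>. x \<in> D}) -` {r} \<inter> space N \<in> sets N" .
qed auto

text \<open>
The finite window case passes to the limit: if \<open>g\<close> approximates \<open>f\<close>, then the pair formed from \<open>g\<close>
approximates the pair formed from \<open>f\<close> with at most twice the error, as translations preserve the measure.
\<close>
lemma edge_vertex_inequality:
  fixes f :: "('a \<Rightarrow> 'n) \<Rightarrow> 't" and \<alpha> :: "'a \<Rightarrow> real" and \<beta> :: real
  assumes f: "f \<in> measurable \<Omega> (count_space A)" and A: "finite A"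
    and S: "finite S" "S \<subseteq> carrier G" and \<alpha>: "\<And>\<sigma>. \<sigma> \<in> S \<Longrightarrow> 0 \<le> \<alpha> \<sigma>"
    and \<beta>: "\<And>W. W \<subseteq> carrier G \<Longrightarrow> finite W \<Longrightarrow> W \<noteq> {} \<Longrightarrow>
        \<beta> * card W \<le> (\<Sum>\<sigma>\<in>S. \<alpha> \<sigma> * card (W \<union> (\<sigma> <# W)))"
  shows "\<beta> * \<H>(f) \<le> (\<Sum>\<sigma>\<in>S. \<alpha> \<sigma> * \<H>(\<lambda>z. (f z, f (translate G (inv \<sigma>) z))))"
proof -
  let ?T = "\<lambda>\<sigma>. translate G (inv \<sigma>)"
  have T: "?T \<sigma> \<in> measurable \<Omega> \<Omega>" "distr \<Omega> \<Omega> (?T \<sigma>) = \<Omega>" if "\<sigma> \<in> S" for \<sigma>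
    using that S translate_measurable[of "inv \<sigma>"] distr_translate[of "inv \<sigma>"] by auto
  have simple: "simple_function \<Omega> g" if "g \<in> measurable \<Omega> (count_space A)" for g
    using that A by (rule simple_function_finite_codomain)
  have fA: "f ` space \<Omega> \<subseteq> A" using f by (auto dest: measurable_space)
  define approx where "approx n g \<longleftrightarrow> g \<in> measurable \<Omega> (count_space A) \<and>
      prob {z\<in>space \<Omega>. g z \<noteq> f z} < inverse (Suc n) \<and>
      \<beta> * \<H>(g) \<le> (\<Sum>\<sigma>\<in>S. \<alpha> \<sigma> * \<H>(\<lambda>z. (g z, g (?T \<sigma> z))))" for n g
  have "\<exists>g. approx n g" for n
  proof (rule window_function_approximation[OF f A, of "inverse (Suc n)"])
    fix B \<D> g
    assume B: "finite B" "B \<subseteq> carrier G" and D: "finite \<D>" "\<D> \<subseteq> sets N"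
      and g: "\<And>z z'. z \<in> space \<Omega> \<Longrightarrow> z' \<in> space \<Omega> \<Longrightarrow>
          \<forall>i\<in>B. {D\<in>\<D>. z i \<in> D} = {D\<in>\<D>. z' i \<in> D} \<Longrightarrow> g z = g z'"
      and gA: "g ` space \<Omega> \<subseteq> A" and close: "prob {z\<in>space \<Omega>. g z \<noteq> f z} < inverse (Suc n)"
    have fin: "finite (Pow \<D>)" using D by simp
    have pat: "simple_function \<Omega> (\<lambda>z. {D\<in>\<D>. z i \<in> D})" if "i \<in> B" for i
    proof -
      have "(\<lambda>z. {D\<in>\<D>. z i \<in> D}) \<in> measurable \<Omega> (count_space (Pow \<D>))"
        using that B
        by (intro measurable_compose[OF measurable_component_singleton[of i "carrier G" "\<lambda>_. N"]
              pattern_measurable[OF D]]) auto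
      then show ?thesis
        using fin by (rule simple_function_finite_codomain)
    qed
    have "simple_function \<Omega> (tuple (\<lambda>i z. {D\<in>\<D>. z i \<in> D}) B)"
      using B(1) pat by (rule simple_function_tuple)
    then have "simple_function \<Omega> g"
      by (rule simple_function_determined) (unfold tuple_eq_iff, rule g)
    then have "g \<in> measurable \<Omega> (count_space A)"
      using gA A by (subst measurable_count_space_eq2) (auto dest: simple_functionD)
    moreover have "\<beta> * \<H>(g) \<le> (\<Sum>\<sigma>\<in>S. \<alpha> \<sigma> * \<H>(\<lambda>z. (g z, g (?T \<sigma> z))))"
      by (rule finite_window_inequality[OF pattern_measurable[OF D] fin B g S \<alpha> \<beta>])
    ultimately show "\<exists>g. approx n g" using close unfolding approx_def by blast
  qed simp
  then obtain g where "\<And>n. approx n (g n)"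
    by metis
  then have g: "\<And>n. g n \<in> measurable \<Omega> (count_space A)"
    and close: "\<And>n. prob {z\<in>space \<Omega>. g n z \<noteq> f z} < inverse (Suc n)"
    and ineq: "\<And>n. \<beta> * \<H>(g n) \<le> (\<Sum>\<sigma>\<in>S. \<alpha> \<sigma> * \<H>(\<lambda>z. (g n z, g n (?T \<sigma> z))))"
    unfolding approx_def by blast+
  have gA: "g n ` space \<Omega> \<subseteq> A" for n using g[of n] by (auto dest: measurable_space)
  have lim: "(\<lambda>n. prob {z\<in>space \<Omega>. g n z \<noteq> f z}) \<longlonglongrightarrow> 0"
    by (rule tendsto_sandwich[OF _ _ tendsto_const LIMSEQ_inverse_real_of_nat])
      (use close in \<open>auto intro!: always_eventually less_imp_le\<close>)
  have vertex: "(\<lambda>n. \<H>(g n)) \<longlonglongrightarrow> \<H>(f)"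
    by (rule entropy_tendsto[OF simple[OF f] fA A simple[OF g] gA lim])
  have edge: "(\<lambda>n. \<H>(\<lambda>z. (g n z, g n (?T \<sigma> z)))) \<longlonglongrightarrow> \<H>(\<lambda>z. (f z, f (?T \<sigma> z)))" if \<sigma>: "\<sigma> \<in> S" for \<sigma>
  proof (rule entropy_tendsto[where A = "A \<times> A"])
    have comp: "simple_function \<Omega> (\<lambda>z. h (?T \<sigma> z))" if "h \<in> measurable \<Omega> (count_space A)" for h
      using measurable_compose[OF T(1)[OF \<sigma>] that] by (rule simple)
    show "simple_function \<Omega> (\<lambda>z. (f z, f (?T \<sigma> z)))" "simple_function \<Omega> (\<lambda>z. (g n z, g n (?T \<sigma> z)))" for n
      using f g by (auto intro!: simple_function_Pair simple comp)
    show "(\<lambda>z. (f z, f (?T \<sigma> z))) ` space \<Omega> \<subseteq> A \<times> A" "(\<lambda>z. (g n z, g n (?T \<sigma> z))) ` space \<Omega> \<subseteq> A \<times> A" for n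
      using fA gA measurable_space[OF T(1)[OF \<sigma>]] by (auto simp: image_subset_iff)
    show "(\<lambda>n. prob {z\<in>space \<Omega>. (g n z, g n (?T \<sigma> z)) \<noteq> (f z, f (?T \<sigma> z))}) \<longlonglongrightarrow> 0"
    proof (rule tendsto_sandwich[OF _ _ tendsto_const])
      have "prob {z\<in>space \<Omega>. (g n z, g n (?T \<sigma> z)) \<noteq> (f z, f (?T \<sigma> z))} \<le> 2 * prob {z\<in>space \<Omega>. g n z \<noteq> f z}" for n
      proof -
        let ?N = "{z\<in>space \<Omega>. g n z \<noteq> f z}"
        have N: "?N \<in> events"
          using simple[OF g] simple[OF f] by (rule sets_simple_function_neq)
        have TN: "?T \<sigma> -` ?N \<inter> space \<Omega> \<in> events"
          using T(1)[OF \<sigma>] N by (rule measurable_sets)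
        have "prob {z\<in>space \<Omega>. (g n z, g n (?T \<sigma> z)) \<noteq> (f z, f (?T \<sigma> z))} \<le> prob (?N \<union> (?T \<sigma> -` ?N \<inter> space \<Omega>))"
          using N TN measurable_space[OF T(1)[OF \<sigma>]] by (intro finite_measure_mono) auto
        also have "\<dots> \<le> prob ?N + prob (?T \<sigma> -` ?N \<inter> space \<Omega>)"
          using N TN by (rule measure_Un_le)
        also have "prob (?T \<sigma> -` ?N \<inter> space \<Omega>) = prob ?N"
          using measure_distr[OF T(1)[OF \<sigma>] N] T(2)[OF \<sigma>] by simp
        finally show ?thesis by simp
      qed
      then show "\<forall>\<^sub>F n in sequentially. prob {z\<in>space \<Omega>. (g n z, g n (?T \<sigma> z)) \<noteq> (f z, f (?T \<sigma> z))}
          \<le> 2 * prob {z\<in>space \<Omega>. g n z \<noteq> f z}" by simp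
      show "(\<lambda>n. 2 * prob {z\<in>space \<Omega>. g n z \<noteq> f z}) \<longlonglongrightarrow> 0"
        using tendsto_mult_right_zero[OF lim] by simp
    qed simp
  qed (use A in auto)
  have "(\<lambda>n. \<beta> * \<H>(g n)) \<longlonglongrightarrow> \<beta> * \<H>(f)"
    using vertex by (intro tendsto_intros)
  moreover have "(\<lambda>n. \<Sum>\<sigma>\<in>S. \<alpha> \<sigma> * \<H>(\<lambda>z. (g n z, g n (?T \<sigma> z))))
      \<longlonglongrightarrow> (\<Sum>\<sigma>\<in>S. \<alpha> \<sigma> * \<H>(\<lambda>z. (f z, f (?T \<sigma> z))))"
    using edge by (intro tendsto_sum tendsto_mult tendsto_const) auto
  ultimately show ?thesis
    by (rule LIMSEQ_le) (use ineq in auto)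
qed

end

section \<open>Transfer to factors of i.i.d. processes\<close>

lemma entropy_factor_through:
  assumes P: "prob_space P" and Q: "prob_space (distr P M Z)"
    and Z: "Z \<in> measurable P M" and f: "f \<in> measurable M S"
    and eq: "\<And>\<omega>. \<omega> \<in> space P \<Longrightarrow> X \<omega> = f (Z \<omega>)"
  shows "prob_space.entropy P b S X = prob_space.entropy (distr P M Z) b S f"
proof -
  have "distr P S X = distr P S (f \<circ> Z)"
    using eq by (intro distr_cong) auto
  also have "\<dots> = distr (distr P M Z) S f"
    using f Z by (rule distr_distr[symmetric])
  finally show ?thesis
    by (simp add: prob_space.entropy_def[OF P] prob_space.entropy_def[OF Q])
qed

theorem theorem3p4:
  fixes G :: "('g, 'r) monoid_scheme"
    and S :: "'g set"
    and P :: "'w measure"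
    and A :: "'t set"
    and X :: "'g \<Rightarrow> 'w \<Rightarrow> 't"
    and \<alpha> :: "'g \<Rightarrow> real"
    and b :: real
  assumes "group G"
    and "infinite (carrier G)"
    and "S \<subseteq> carrier G"
    and "finite S"
    and "\<forall>\<sigma>\<in>S. inv\<^bsub>G\<^esub> \<sigma> \<in> S"
    and "generate G S = carrier G"
    and "prob_space P"
    and "finite A"
    and "prob_space.factor_of_iid P G (count_space A) X"
    and "\<forall>\<sigma>\<in>S. 0 \<le> \<alpha> \<sigma>"
    and "\<forall>\<sigma>\<in>S. \<alpha> \<sigma> = \<alpha> (inv\<^bsub>G\<^esub> \<sigma>)"
    and "1 < b"
  shows "(\<Sum>\<sigma>\<in>S. \<alpha> \<sigma> * prob_space.entropy P b (count_space (A \<times> A)) (\<lambda>\<omega>. (X \<one>\<^bsub>G\<^esub> \<omega>, X \<sigma> \<omega>)))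
    \<ge> (INF W\<in>{W. W \<subseteq> carrier G \<and> finite W \<and> W \<noteq> {}}.
          (\<Sum>\<sigma>\<in>S. \<alpha> \<sigma> * real (card (W \<union> (\<sigma> <#\<^bsub>G\<^esub> W)))) / real (card W))
      * prob_space.entropy P b (count_space A) (X \<one>\<^bsub>G\<^esub>)"
proof -
  interpret G: group G by fact
  interpret P: prob_space P by fact
  have one: "\<one>\<^bsub>G\<^esub> \<in> carrier G" by simp
  obtain Z F where Z: "P.iid_uniform (carrier G) Z"
    and F: "F \<in> measurable (PiM (carrier G) (\<lambda>_. uniform_unit)) (PiM (carrier G) (\<lambda>_. count_space A))"
    and equi: "equivariant G (space (PiM (carrier G) (\<lambda>_. uniform_unit))) F"
    and X: "\<And>\<omega> \<gamma>. \<omega> \<in> space P \<Longrightarrow> \<gamma> \<in> carrier G \<Longrightarrow> X \<gamma> \<omega> = F (\<lambda>\<delta>\<in>carrier G. Z \<delta> \<omega>) \<gamma>"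
    using assms(9) unfolding P.factor_of_iid_def by blast
  have ind: "P.indep_vars (\<lambda>_. uniform_unit) Z (carrier G)"
    and law: "\<And>i. i \<in> carrier G \<Longrightarrow> distr P uniform_unit (Z i) = uniform_unit"
    using Z unfolding P.iid_uniform_def by auto
  have Z_meas: "Z i \<in> measurable P uniform_unit" if "i \<in> carrier G" for i
    using ind that by (auto simp: P.indep_vars_def)
  have "prob_space uniform_unit"
    using P.prob_space_distr[OF Z_meas[OF one]] law[OF one] by simp
  then interpret bernoulli_shift G uniform_unit b
    using assms(12) G.group_axioms by (simp add: bernoulli_shift_def bernoulli_shift_axioms_def)
  let ?Z = "\<lambda>\<omega>. \<lambda>\<delta>\<in>carrier G. Z \<delta> \<omega>"
  have Z_all: "?Z \<in> measurable P \<Omega>"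
    using Z_meas by (rule measurable_restrict)
  have "distr P \<Omega> ?Z = (\<Pi>\<^sub>M i\<in>carrier G. distr P uniform_unit (Z i))"
    using ind one Z_meas by (subst (asm) P.indep_vars_iff_distr_eq_PiM') auto
  then have Z_law: "distr P \<Omega> ?Z = \<Omega>"
    using law by (simp cong: PiM_cong)
  define f where "f z = F z \<one>\<^bsub>G\<^esub>" for z
  have f: "f \<in> measurable \<Omega> (count_space A)"
    unfolding f_def[abs_def] using F one by (rule measurable_compose[OF _ measurable_component_singleton])
  \<comment> \<open>Equivariance expresses the whole process through its value at the unit element.\<close>
  have X_eq: "X \<sigma> \<omega> = f (translate G (inv\<^bsub>G\<^esub> \<sigma>) (?Z \<omega>))" if "\<sigma> \<in> carrier G" "\<omega> \<in> space P" for \<sigma> \<omega>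
  proof -
    have "?Z \<omega> \<in> space \<Omega>"
      using Z_all that(2) by (rule measurable_space)
    then have "F (translate G (inv\<^bsub>G\<^esub> \<sigma>) (?Z \<omega>)) = translate G (inv\<^bsub>G\<^esub> \<sigma>) (F (?Z \<omega>))"
      using equi that(1) unfolding equivariant_def by blast
    then show ?thesis
      using that by (simp add: f_def X translate_apply)
  qed
  have X_one: "X \<one>\<^bsub>G\<^esub> \<omega> = f (?Z \<omega>)" if "\<omega> \<in> space P" for \<omega>
    using that by (simp add: X f_def)
  have entropy_P: "P.entropy b (count_space R) Y = shannon g"
    if "finite R" and g: "g \<in> measurable \<Omega> (count_space R)" and "\<And>\<omega>. \<omega> \<in> space P \<Longrightarrow> Y \<omega> = g (?Z \<omega>)"
    for R and g :: "('g \<Rightarrow> real) \<Rightarrow> 'k" and Y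
  proof -
    have "P.entropy b (count_space R) Y = prob_space.entropy (distr P \<Omega> ?Z) b (count_space R) g"
      using that prob_space_axioms Z_law Z_all by (intro entropy_factor_through) (auto simp: P.prob_space_axioms)
    also have "\<dots> = shannon g"
      unfolding Z_law using that measurable_space[OF g] by (intro entropy_enlarge_codomain simple_function_finite_codomain[OF g]) auto
    finally show ?thesis .
  qed
  have vertex: "P.entropy b (count_space A) (X \<one>\<^bsub>G\<^esub>) = shannon f"
    using assms(8) f X_one by (rule entropy_P)
  have edge: "P.entropy b (count_space (A \<times> A)) (\<lambda>\<omega>. (X \<one>\<^bsub>G\<^esub> \<omega>, X \<sigma> \<omega>)) =
      shannon (\<lambda>z. (f z, f (translate G (inv\<^bsub>G\<^esub> \<sigma>) z)))" if "\<sigma> \<in> S" for \<sigma>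
  proof (rule entropy_P)
    have \<sigma>: "\<sigma> \<in> carrier G" using that assms(3) by blast
    have "(\<lambda>z. f (translate G (inv\<^bsub>G\<^esub> \<sigma>) z)) \<in> measurable \<Omega> (count_space A)"
      using \<sigma> f by (intro measurable_compose[OF translate_measurable]) auto
    with f have "(\<lambda>z. (f z, f (translate G (inv\<^bsub>G\<^esub> \<sigma>) z))) \<in> measurable \<Omega> (count_space A \<Otimes>\<^sub>M count_space A)"
      by (rule measurable_Pair)
    then show "(\<lambda>z. (f z, f (translate G (inv\<^bsub>G\<^esub> \<sigma>) z))) \<in> measurable \<Omega> (count_space (A \<times> A))"
      using assms(8) by (simp add: pair_measure_count_space)
    show "(X \<one>\<^bsub>G\<^esub> \<omega>, X \<sigma> \<omega>) = (f (?Z \<omega>), f (translate G (inv\<^bsub>G\<^esub> \<sigma>) (?Z \<omega>)))" if "\<omega> \<in> space P" for \<omega>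
      using X_one[OF that] X_eq[OF \<sigma> that] by simp
  qed (use assms(8) in simp)
  let ?ratio = "\<lambda>W. (\<Sum>\<sigma>\<in>S. \<alpha> \<sigma> * real (card (W \<union> (\<sigma> <#\<^bsub>G\<^esub> W)))) / real (card W)"
  let ?\<W> = "{W. W \<subseteq> carrier G \<and> finite W \<and> W \<noteq> {}}"
  have "0 \<le> ?ratio W" for W
    using assms(10) by (intro divide_nonneg_nonneg sum_nonneg mult_nonneg_nonneg) auto
  then have bdd: "bdd_below (?ratio ` ?\<W>)"
    by (intro bdd_belowI[of _ 0]) auto
  have "(INF W\<in>?\<W>. ?ratio W) * card W \<le> (\<Sum>\<sigma>\<in>S. \<alpha> \<sigma> * card (W \<union> (\<sigma> <#\<^bsub>G\<^esub> W)))"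
    if W: "W \<subseteq> carrier G" "finite W" "W \<noteq> {}" for W
  proof -
    have "(INF W\<in>?\<W>. ?ratio W) \<le> ?ratio W"
      using W by (intro cINF_lower bdd) auto
    moreover have "0 < real (card W)" using W by (simp add: card_gt_0_iff)
    ultimately show ?thesis by (simp add: pos_le_divide_eq)
  qed
  then have "(INF W\<in>?\<W>. ?ratio W) * shannon f \<le>
      (\<Sum>\<sigma>\<in>S. \<alpha> \<sigma> * shannon (\<lambda>z. (f z, f (translate G (inv\<^bsub>G\<^esub> \<sigma>) z))))"
    using assms(10) by (intro edge_vertex_inequality[OF f assms(8,4,3)]) auto
  then show ?thesis
    unfolding vertex using edge by simp
qed

end
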